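(* Let $H$ be an infinite dimensional complex Hilbert space and let $T \in \overline{\mathcal{AN}(H)}$ be self-adjoint. Let $T = W|T|$ be the polar decomposition of $T$. Then $T = \alpha W - K_1 + K_2$, where $\alpha \geq 0$ and $K_1, K_2$ are self-adjoint compact operators on $H$ with $K_1K_2 = 0$ and $K^2_1 \leq \alpha^2 I$.
   Context: $\mathcal{B}(H)$ is the space of bounded linear operators on $H$ with the operator norm. An operator is norm attaining if its norm is attained at some unit vector of its domain. $T\in\mathcal{B}(H)$ is absolutely norm attaining (an $\mathcal{AN}$-operator) if for every nonzero closed subspace $M$ of $H$ the restriction $T|_M:M\to H$ is norm attaining. $\mathcal{AN}(H)$ is the set of such operators, and $\overline{\mathcal{AN}(H)}$ its closure in the operator norm. For self-adjoint $T_1,T_2$, $T_1\le T_2$ means $T_2-T_1$ is positive. $|T|=(T^*T)^{1/2}$, and the polar decomposition of $T$ is $T=W|T|$ with $W$ the unique partial isometry satisfying $T=W|T|$ and $N(W)=N(T)$ ($N(\cdot)$ is the null space). *)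

theory Defs
  imports "HOL-Analysis.Analysis"
begin

text \<open>The inner product is linear in its first argument.\<close>

class complex_hilbert_space = banach +
  fixes scaleC :: "complex \<Rightarrow> 'a \<Rightarrow> 'a" (infixr "*\<^sub>C" 75)
    and cinner :: "'a \<Rightarrow> 'a \<Rightarrow> complex"
  assumes scaleC_add_right: "a *\<^sub>C (x + y) = a *\<^sub>C x + a *\<^sub>C y"
    and scaleC_add_left: "(a + b) *\<^sub>C x = a *\<^sub>C x + b *\<^sub>C x"
    and scaleC_scaleC: "a *\<^sub>C b *\<^sub>C x = (a * b) *\<^sub>C x"
    and scaleC_one: "1 *\<^sub>C x = x"
    and scaleR_scaleC: "r *\<^sub>R x = complex_of_real r *\<^sub>C x"
    and cinner_commute: "cinner x y = cnj (cinner y x)"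
    and cinner_add_left: "cinner (x + y) z = cinner x z + cinner y z"
    and cinner_scaleC_left: "cinner (a *\<^sub>C x) y = a * cinner x y"
    and cinner_self: "cinner x x = complex_of_real ((norm x)\<^sup>2)"

global_interpretation complex_vector:
  vector_space "scaleC :: complex \<Rightarrow> 'a \<Rightarrow> 'a::complex_hilbert_space"
  by unfold_locales (fact scaleC_add_right scaleC_add_left scaleC_scaleC scaleC_one)+

text \<open>
  The space $B(H)$ is the set of complex linear elements of the library type \<open>'a \<Rightarrow>\<^sub>L 'a\<close> of
  bounded real linear maps. This set is closed for the operator norm, which does not depend on
  the scalars, so closures of its subsets in \<open>'a \<Rightarrow>\<^sub>L 'a\<close> and in $B(H)$ coincide.
\<close>

definition bounded_ops :: "('a::complex_hilbert_space \<Rightarrow>\<^sub>L 'a) set" where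
  "bounded_ops = {T. \<forall>c x. blinfun_apply T (c *\<^sub>C x) = c *\<^sub>C blinfun_apply T x}"

definition null_space :: "('a::complex_hilbert_space \<Rightarrow>\<^sub>L 'a) \<Rightarrow> 'a set" where
  "null_space T = {x. blinfun_apply T x = 0}"

definition norm_on :: "'a set \<Rightarrow> ('a::complex_hilbert_space \<Rightarrow>\<^sub>L 'a) \<Rightarrow> real" where
  "norm_on M T = (SUP x\<in>{x\<in>M. norm x \<le> 1}. norm (blinfun_apply T x))"

definition norm_attaining_on :: "'a set \<Rightarrow> ('a::complex_hilbert_space \<Rightarrow>\<^sub>L 'a) \<Rightarrow> bool" where
  "norm_attaining_on M T \<longleftrightarrow> (\<exists>x\<in>M. norm x = 1 \<and> norm (blinfun_apply T x) = norm_on M T)"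

definition AN_ops :: "('a::complex_hilbert_space \<Rightarrow>\<^sub>L 'a) set" where
  "AN_ops = {T \<in> bounded_ops.
     \<forall>M. complex_vector.subspace M \<and> closed M \<and> M \<noteq> {0} \<longrightarrow> norm_attaining_on M T}"

text \<open>The adjoint exists and is unique for every operator in \<open>bounded_ops\<close>.\<close>

definition adj :: "('a::complex_hilbert_space \<Rightarrow>\<^sub>L 'a) \<Rightarrow> 'a \<Rightarrow>\<^sub>L 'a" where
  "adj T = (THE S. \<forall>x y. cinner (blinfun_apply T x) y = cinner x (blinfun_apply S y))"

definition self_adjoint :: "('a::complex_hilbert_space \<Rightarrow>\<^sub>L 'a) \<Rightarrow> bool" where
  "self_adjoint T \<longleftrightarrow> T \<in> bounded_ops \<and> adj T = T"

definition positive_op :: "('a::complex_hilbert_space \<Rightarrow>\<^sub>L 'a) \<Rightarrow> bool" where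
  "positive_op T \<longleftrightarrow> self_adjoint T \<and> (\<forall>x. 0 \<le> Re (cinner (blinfun_apply T x) x))"

definition op_le :: "('a::complex_hilbert_space \<Rightarrow>\<^sub>L 'a) \<Rightarrow> ('a \<Rightarrow>\<^sub>L 'a) \<Rightarrow> bool" where
  "op_le S T \<longleftrightarrow> self_adjoint S \<and> self_adjoint T \<and> positive_op (T - S)"

text \<open>Every positive operator has exactly one positive square root.\<close>

definition op_sqrt :: "('a::complex_hilbert_space \<Rightarrow>\<^sub>L 'a) \<Rightarrow> 'a \<Rightarrow>\<^sub>L 'a" where
  "op_sqrt A = (THE P. positive_op P \<and> P o\<^sub>L P = A)"

definition op_abs :: "('a::complex_hilbert_space \<Rightarrow>\<^sub>L 'a) \<Rightarrow> 'a \<Rightarrow>\<^sub>L 'a" where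
  "op_abs T = op_sqrt (adj T o\<^sub>L T)"

definition orth_compl :: "'a::complex_hilbert_space set \<Rightarrow> 'a set" where
  "orth_compl M = {x. \<forall>y\<in>M. cinner x y = 0}"

definition partial_isometry :: "('a::complex_hilbert_space \<Rightarrow>\<^sub>L 'a) \<Rightarrow> bool" where
  "partial_isometry W \<longleftrightarrow>
     W \<in> bounded_ops \<and> (\<forall>x\<in>orth_compl (null_space W). norm (blinfun_apply W x) = norm x)"

definition polar_decomposition ::
  "('a::complex_hilbert_space \<Rightarrow>\<^sub>L 'a) \<Rightarrow> ('a \<Rightarrow>\<^sub>L 'a) \<Rightarrow> bool" where
  "polar_decomposition T W \<longleftrightarrow>
     partial_isometry W \<and> T = W o\<^sub>L op_abs T \<and> null_space W = null_space T"

definition compact_op :: "('a::complex_hilbert_space \<Rightarrow>\<^sub>L 'a) \<Rightarrow> bool" where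
  "compact_op K \<longleftrightarrow> K \<in> bounded_ops \<and> compact (closure (blinfun_apply K ` cball 0 1))"

end

theory Submission imports Defs begin

text \<open>
  If \<open>S\<close> is absolutely norm attaining, the values \<open>norm (S x)\<close> on unit vectors orthogonal to large
  finite sets concentrate at a single number: otherwise an orthonormal sequence with mutually
  orthogonal images and strictly increasing \<open>norm (S (g n))\<close> spans a subspace on which the norm is
  not attained. This property survives norm limits, so \<open>T\<^sup>2 - \<alpha>\<^sup>2\<close>, and with it \<open>K = |T| - \<alpha>\<close>, is
  compact for some \<open>\<alpha> \<ge> 0\<close>. Split \<open>K\<close> into its positive and negative parts \<open>K + L\<close> and \<open>L\<close>. As \<open>W\<close>
  is self-adjoint and commutes with \<open>|T|\<close>, the operators \<open>K\<^sub>1 = W L\<close> and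
  \<open>K\<^sub>2 = W (K + L)\<close> are self-adjoint with product \<open>W\<^sup>2 L (K + L) = 0\<close>, and positivity of \<open>|T|\<close> gives
  \<open>L \<le> \<alpha>\<close>.
\<close>

subsection \<open>Inner product and adjoints\<close>

text \<open>Absolute norm attainment is not stable under norm limits, so it is first converted into
  a statement with a margin: given \<open>a < b\<close>, the values at unit vectors off some finite
  set either all exceed \<open>a\<close> or all stay below \<open>b\<close>. A small perturbation
  only eats into the gap. Infinite dimension keeps the resulting number \<alpha> finite, since
  complements of finite sets never run out of unit vectors. Squares enter because the quadratic form
  of T^2 - \<alpha>^2 sees exactly the numbers \<open>norm (T x)\<close>; the way back to |T| is T^2
  - \<alpha>^2 = (|T| + \<alpha>)(|T| - \<alpha>), whose first factor is bounded below by \<alpha>.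
  For \<alpha> = 0 that bound is void, but then |T| itself is small, because |T| x and T x have the
  same norm. The signs in the result come from T = W (\<alpha> + K) and K = (K + L) - L.\<close>

lemma cinner_add_right: "cinner x (y + z) = cinner x y + cinner x z"
  for x y z :: "'a::complex_hilbert_space"
  by (metis cinner_add_left cinner_commute complex_cnj_add)

lemma cinner_scaleC_right: "cinner x (c *\<^sub>C y) = cnj c * cinner x y"
  for x y :: "'a::complex_hilbert_space"
  by (metis cinner_scaleC_left cinner_commute complex_cnj_mult)

lemma norm_scaleC: "norm (c *\<^sub>C x) = cmod c * norm x"
  for x :: "'a::complex_hilbert_space"
proof -
  have "complex_of_real ((norm (c *\<^sub>C x))\<^sup>2) = c * cnj c * complex_of_real ((norm x)\<^sup>2)"
    by (simp only: cinner_self[symmetric] cinner_scaleC_left cinner_scaleC_right ac_simps)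
  then have "complex_of_real ((norm (c *\<^sub>C x))\<^sup>2) = complex_of_real ((cmod c * norm x)\<^sup>2)"
    by (simp only: complex_norm_square[symmetric] of_real_mult[symmetric] power_mult_distrib)
  then have "(norm (c *\<^sub>C x))\<^sup>2 = (cmod c * norm x)\<^sup>2"
    by (simp only: of_real_eq_iff)
  then show ?thesis
    by (simp add: power2_eq_iff_nonneg)
qed

lemma norm_add_squared: "(norm (x + y))\<^sup>2 = (norm x)\<^sup>2 + (norm y)\<^sup>2 + 2 * Re (cinner x y)"
  for x y :: "'a::complex_hilbert_space"
proof -
  have "complex_of_real ((norm (x + y))\<^sup>2) =
      complex_of_real ((norm x)\<^sup>2) + complex_of_real ((norm y)\<^sup>2) + (cinner x y + cnj (cinner x y))"
    by (simp only: cinner_self[symmetric] cinner_add_left cinner_add_right cinner_commute[of y x])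
      (simp add: cinner_commute[of y x])
  then have "complex_of_real ((norm (x + y))\<^sup>2) =
      complex_of_real ((norm x)\<^sup>2 + (norm y)\<^sup>2 + 2 * Re (cinner x y))"
    by (simp add: complex_add_cnj)
  then show ?thesis
    by (simp only: of_real_eq_iff)
qed

lemma norm_cinner_le: "cmod (cinner x y) \<le> norm x * norm y"
  for x y :: "'a::complex_hilbert_space"
proof (cases "y = 0")
  case True
  have "cinner x (0 *\<^sub>C y) = 0"
    by (simp only: cinner_scaleC_right) simp
  then show ?thesis
    using True by simp
next
  case False
  define c where "c = cinner x y"
  \<comment> \<open>The vector is \<open>(norm y)^2\<close> times the component of \<open>x\<close>
    orthogonal to \<open>y\<close>; the factor clears the denominator.\<close>
  have "0 \<le> (norm (complex_of_real ((norm y)\<^sup>2) *\<^sub>C x + (- c) *\<^sub>C y))\<^sup>2"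
    by simp
  also have "\<dots> = ((norm y)\<^sup>2)\<^sup>2 * (norm x)\<^sup>2 + (cmod c)\<^sup>2 * (norm y)\<^sup>2
      + 2 * Re (complex_of_real ((norm y)\<^sup>2) * (- cnj c * c))"
    unfolding norm_add_squared norm_scaleC cinner_scaleC_left cinner_scaleC_right c_def
    by (simp add: power_mult_distrib mult.assoc norm_power algebra_simps)
  also have "\<dots> = (norm y)\<^sup>2 * ((norm y)\<^sup>2 * (norm x)\<^sup>2 - (cmod c)\<^sup>2)"
    by (simp add: algebra_simps cmod_power2 norm_power power2_eq_square[of "Re c"]
        power2_eq_square[of "Im c"] power2_eq_square[of "(norm y)\<^sup>2"])
  finally have "(cmod c)\<^sup>2 \<le> (norm x * norm y)\<^sup>2"
    using False by (simp add: zero_le_mult_iff power_mult_distrib mult.commute)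
  then show ?thesis
    unfolding c_def by (simp add: power2_le_iff_abs_le)
qed

interpretation cinner: bounded_bilinear "cinner :: 'a::complex_hilbert_space \<Rightarrow> 'a \<Rightarrow> complex"
proof
  show "\<exists>K. \<forall>a b. norm (cinner a (b::'a)) \<le> norm a * norm b * K"
    by (rule exI[of _ 1]) (simp add: norm_cinner_le)
qed (auto simp: cinner_add_left cinner_add_right scaleR_scaleC cinner_scaleC_left
    cinner_scaleC_right scaleR_conv_of_real)

lemma Re_cinner_self: "Re (cinner x x) = (norm x)\<^sup>2"
  for x :: "'a::complex_hilbert_space"
  by (simp add: cinner_self)

lemma cinner_zero_commute: "cinner x y = 0 \<longleftrightarrow> cinner y x = 0"
  for x y :: "'a::complex_hilbert_space"
  using cinner_commute[of x y] by auto

lemma Re_cinner_commute: "Re (cinner x y) = Re (cinner y x)"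
  for x y :: "'a::complex_hilbert_space"
  using cinner_commute[of x y] by auto

lemma cinner_self_eq_0: "cinner x x = 0 \<longleftrightarrow> x = 0"
  for x :: "'a::complex_hilbert_space"
  by (simp add: cinner_self)

lemma norm_diff_squared: "(norm (x - y))\<^sup>2 = (norm x)\<^sup>2 + (norm y)\<^sup>2 - 2 * Re (cinner x y)"
  for x y :: "'a::complex_hilbert_space"
  using norm_add_squared[of x "- y"] by (simp add: cinner.minus_right)

lemma bounded_linear_scaleC: "bounded_linear (scaleC c :: 'a::complex_hilbert_space \<Rightarrow> 'a)"
  by (rule bounded_linear_intro[where K = "cmod c"])
    (auto simp: scaleC_add_right scaleR_scaleC scaleC_scaleC norm_scaleC mult.commute)

text \<open>A minimizing sequence for the distance to \<open>V\<close> is Cauchy by the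
  parallelogram law, and minimality at its limit gives orthogonality. Working with real subspaces
  and real parts covers both kernels of real functionals and complex subspaces.\<close>

lemma real_projection:
  fixes x :: "'a::complex_hilbert_space"
  assumes V: "closed V" "subspace V"
  obtains v where "v \<in> V" "\<And>w. w \<in> V \<Longrightarrow> Re (cinner (x - v) w) = 0"
proof -
  define D where "D = (INF v\<in>V. (norm (x - v))\<^sup>2)"
  have ne: "V \<noteq> {}"
    using subspace_0[OF V(2)] by auto
  have bdd: "bdd_below ((\<lambda>v. (norm (x - v))\<^sup>2) ` V)"
    by (rule bdd_belowI[of _ 0]) auto
  have D_le: "D \<le> (norm (x - v))\<^sup>2" if "v \<in> V" for v
    unfolding D_def by (rule cINF_lower[OF bdd that])
  have "\<exists>v\<in>V. (norm (x - v))\<^sup>2 < D + 1 / real (Suc n)" for n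
    using cINF_less_iff[OF ne bdd, of "D + 1 / real (Suc n)"] by (simp add: D_def)
  then obtain v where v: "\<And>n. v n \<in> V" "\<And>n. (norm (x - v n))\<^sup>2 < D + 1 / real (Suc n)"
    by metis
  have par: "(norm (v m - v n))\<^sup>2 \<le> 2 / real (Suc m) + 2 / real (Suc n)" for m n
  proof -
    have "(1/2) *\<^sub>R (v m + v n) \<in> V"
      using V(2) v(1) by (simp add: subspace_add subspace_scale)
    then have "4 * D \<le> 4 * (norm (x - (1/2) *\<^sub>R (v m + v n)))\<^sup>2"
      using D_le by simp
    also have "\<dots> = (norm (2 *\<^sub>R (x - (1/2) *\<^sub>R (v m + v n))))\<^sup>2"
      by (simp only: norm_scaleR power_mult_distrib) simp
    also have "2 *\<^sub>R (x - (1/2) *\<^sub>R (v m + v n)) = (x - v m) + (x - v n)"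
      by (simp add: algebra_simps scaleR_2)
    finally have 1: "4 * D \<le> (norm ((x - v m) + (x - v n)))\<^sup>2" .
    have "(norm (v m - v n))\<^sup>2 = (norm ((x - v n) - (x - v m)))\<^sup>2"
      by simp
    also have "\<dots> = 2 * (norm (x - v m))\<^sup>2 + 2 * (norm (x - v n))\<^sup>2 - (norm ((x - v m) + (x - v n)))\<^sup>2"
      unfolding norm_diff_squared[of "x - v n"] norm_add_squared[of "x - v m"]
      by (simp add: Re_cinner_commute[of "x - v n"])
    finally show ?thesis
      using 1 v(2)[of m] v(2)[of n] by simp
  qed
  have "Cauchy v"
  proof (rule metric_CauchyI)
    fix e :: real assume e: "e > 0"
    obtain N where N: "4 / e\<^sup>2 < real N"
      using reals_Archimedean2 by blast
    have "dist (v m) (v n) < e" if "m \<ge> N" "n \<ge> N" for m n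
    proof -
      have N0: "real N > 0"
        using N e by (smt (verit) divide_nonneg_pos zero_less_power)
      have "2 / real (Suc k) < 2 / real N" if "k \<ge> N" for k
        using that N0 by (intro divide_strict_left_mono) auto
      then have "(norm (v m - v n))\<^sup>2 < 2 / real N + 2 / real N"
        using par[of m n] that by (smt (verit))
      also have "\<dots> < e\<^sup>2"
        using N N0 e by (simp add: field_simps)
      finally show ?thesis
        using e by (simp add: dist_norm power2_less_imp_less)
    qed
    then show "\<exists>M. \<forall>m\<ge>M. \<forall>n\<ge>M. dist (v m) (v n) < e"
      by blast
  qed
  then obtain u where u: "v \<longlonglongrightarrow> u"
    using Cauchy_convergent convergent_def by blast
  have uV: "u \<in> V"
    using V(1) v(1) u closed_sequentially by blast
  have "(norm (x - u))\<^sup>2 \<le> D"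
  proof (rule LIMSEQ_le)
    show "(\<lambda>n. (norm (x - v n))\<^sup>2) \<longlonglongrightarrow> (norm (x - u))\<^sup>2"
      by (intro tendsto_intros u)
    show "(\<lambda>n. D + 1 / real (Suc n)) \<longlonglongrightarrow> D"
      using tendsto_add[OF tendsto_const LIMSEQ_Suc[OF lim_1_over_n], of D] by simp
    show "\<exists>N. \<forall>n\<ge>N. (norm (x - v n))\<^sup>2 \<le> D + 1 / real (Suc n)"
      using v(2) less_imp_le by blast
  qed
  note u_min = this
  have min: "(norm (x - u))\<^sup>2 \<le> (norm (x - w))\<^sup>2" if "w \<in> V" for w
    using u_min D_le[OF that] by (rule order_trans)
  have "Re (cinner (x - u) w) = 0" if w: "w \<in> V" for w
  proof (cases "w = 0")
    case False
    define r where "r = Re (cinner (x - u) w)"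
    \<comment> \<open>This \<open>t\<close> minimizes the quadratic polynomial computed below;
      comparison with its value at 0 leaves no room for \<open>r\<close> to be nonzero.\<close>
    define t where "t = r / (norm w)\<^sup>2"
    have "u + t *\<^sub>R w \<in> V"
      using V(2) uV w by (simp add: subspace_add subspace_scale)
    from min[OF this] have "(norm (x - u))\<^sup>2 \<le> (norm ((x - u) - t *\<^sub>R w))\<^sup>2"
      by (simp add: algebra_simps)
    also have "\<dots> = (norm (x - u))\<^sup>2 + t\<^sup>2 * (norm w)\<^sup>2 - 2 * t * r"
      unfolding norm_diff_squared[of "x - u"] r_def
      by (simp add: cinner.scaleR_right power_mult_distrib)
    finally have "2 * t * r \<le> t\<^sup>2 * (norm w)\<^sup>2"
      by simp
    then have "r\<^sup>2 / (norm w)\<^sup>2 \<le> 0"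
      using False unfolding t_def by (simp add: power2_eq_square field_simps)
    then show ?thesis
      using False unfolding r_def by (simp add: divide_le_0_iff)
  qed (simp add: cinner.zero_right)
  with uV show thesis
    using that by blast
qed

lemma complex_subspace_imp_subspace: "complex_vector.subspace V \<Longrightarrow> subspace V"
  unfolding complex_vector.subspace_def subspace_def by (auto simp: scaleR_scaleC)

text \<open>The residual of the real projection is orthogonal to \<open>V\<close> also in the
  complex sense, as seen by testing against \<open>w\<close> and \<open>\<i> *\<^sub>C w\<close>; by
  \<open>orth\<close> it then lies in \<open>V\<close>. This is the density criterion behind
  \<open>null_range_dense\<close>.\<close>

lemma closed_complex_subspace_eq_UNIV:
  assumes V: "closed V" "complex_vector.subspace V"
    and orth: "\<And>u. (\<And>w. w \<in> V \<Longrightarrow> cinner u w = 0) \<Longrightarrow> u \<in> V"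
  shows "x \<in> V"
proof -
  obtain v where v: "v \<in> V" "\<And>w. w \<in> V \<Longrightarrow> Re (cinner (x - v) w) = 0"
    using real_projection[OF V(1) complex_subspace_imp_subspace[OF V(2)], of x] by blast
  have "cinner (x - v) w = 0" if "w \<in> V" for w
  proof (rule complex_eqI)
    have "\<i> *\<^sub>C w \<in> V"
      using V(2) that complex_vector.subspace_scale by blast
    from v(2)[OF this] show "Im (cinner (x - v) w) = Im 0"
      by (simp add: cinner_scaleC_right)
  qed (simp add: v(2)[OF that])
  then have "x - v \<in> V"
    using orth by blast
  then show ?thesis
    using v(1) V(2) complex_vector.subspace_add by fastforce
qed

text \<open>A vector \<open>u\<close> orthogonal to the kernel represents \<open>f\<close> up to a
  factor, because \<open>x - (f x / f u) *\<^sub>R u\<close> always lies in the kernel.\<close>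

lemma Riesz_representation_real:
  fixes f :: "'a::complex_hilbert_space \<Rightarrow> real"
  assumes f: "bounded_linear f"
  obtains z where "\<And>x. f x = Re (cinner x z)"
proof (cases "\<forall>x. f x = 0")
  case True
  then show ?thesis
    using that[of 0] by (simp add: cinner.zero_right)
next
  case False
  interpret f: bounded_linear f by (rule f)
  obtain x0 where x0: "f x0 \<noteq> 0"
    using False by blast
  define V where "V = {x. f x = 0}"
  have "closed V"
    unfolding V_def by (intro closed_Collect_eq continuous_intros f.continuous_on)
  moreover have "subspace V"
    unfolding V_def by (rule linear_subspace_kernel[OF f.linear_axioms])
  ultimately obtain v where v: "v \<in> V" "\<And>w. w \<in> V \<Longrightarrow> Re (cinner (x0 - v) w) = 0"
    using real_projection[of V x0] by blast
  define u where "u = x0 - v"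
  have fu: "f u \<noteq> 0"
    using x0 v(1) unfolding u_def V_def by (simp add: f.diff)
  then have u0: "u \<noteq> 0"
    using f.zero by auto
  have "f x = Re (cinner x ((f u / (norm u)\<^sup>2) *\<^sub>R u))" for x
  proof -
    have "x - (f x / f u) *\<^sub>R u \<in> V"
      unfolding V_def using fu by (simp add: f.diff f.scaleR)
    then have "Re (cinner u (x - (f x / f u) *\<^sub>R u)) = 0"
      using v(2) unfolding u_def by blast
    then have "Re (cinner x u) = (f x / f u) * (norm u)\<^sup>2"
      by (simp add: cinner.diff_right cinner.scaleR_right Re_cinner_self Re_cinner_commute[of u x])
    then show ?thesis
      using fu u0 by (simp add: cinner.scaleR_right)
  qed
  then show ?thesis
    by (rule that)
qed

section \<open>Existence of adjoints and the symmetric form of self-adjointness\<close>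

lemma bounded_opsD: "T \<in> bounded_ops \<Longrightarrow> blinfun_apply T (c *\<^sub>C x) = c *\<^sub>C blinfun_apply T x"
  by (simp add: bounded_ops_def)

lemma adjoint_exists:
  fixes T :: "'a::complex_hilbert_space \<Rightarrow>\<^sub>L 'a"
  assumes T: "T \<in> bounded_ops"
  obtains S :: "'a \<Rightarrow>\<^sub>L 'a" where "\<And>x y. cinner (T x) y = cinner x (S y)"
proof -
  have "\<exists>z. \<forall>x. cinner (T x) y = cinner x z" for y
  proof -
    have "bounded_linear (\<lambda>x. Re (cinner (T x) y))"
      by (intro bounded_linear_compose[OF bounded_linear_Re]
          bounded_linear_compose[OF cinner.bounded_linear_left] blinfun.bounded_linear_right)
    then obtain z where z: "\<And>x. Re (cinner (T x) y) = Re (cinner x z)"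
      using Riesz_representation_real by blast
    \<comment> \<open>The real functional determines the complex one: by complex linearity of
      \<open>T\<close>, imaginary parts are real parts at \<open>\<i> *\<^sub>C x\<close> up to
      sign.\<close>
    have "Im (cinner (T x) y) = Im (cinner x z)" for x
      using z[of "\<i> *\<^sub>C x"] by (simp add: bounded_opsD[OF T] cinner_scaleC_left)
    with z show ?thesis
      by (metis complex_eqI)
  qed
  then obtain g where g: "\<And>x y. cinner (T x) y = cinner x (g y)"
    by metis
  have eqI: "a = b" if "\<And>x. cinner x a = cinner x b" for a b :: 'a
    using that[of "a - b"] cinner_self_eq_0[of "a - b"] by (simp add: cinner.diff_right)
  have "bounded_linear g"
  proof (rule bounded_linear_intro[where K = "norm T"])
    show "g (x + y) = g x + g y" for x y
      by (rule eqI) (simp add: g[symmetric] cinner_add_right)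
    show "g (r *\<^sub>R x) = r *\<^sub>R g x" for r x
      by (rule eqI) (simp add: g[symmetric] cinner.scaleR_right)
    show "norm (g y) \<le> norm y * norm T" for y
    proof (cases "g y = 0")
      case False
      have "(norm (g y))\<^sup>2 = Re (cinner (T (g y)) y)"
        by (simp add: g Re_cinner_self)
      also have "\<dots> \<le> norm (T (g y)) * norm y"
        using norm_cinner_le complex_Re_le_cmod order_trans by blast
      also have "\<dots> \<le> norm T * norm (g y) * norm y"
        by (simp add: mult_right_mono norm_blinfun)
      finally show ?thesis
        using False by (simp add: power2_eq_square mult.commute mult.left_commute)
    qed simp
  qed
  then show thesis
    using that[of "Blinfun g"] g by (simp add: bounded_linear_Blinfun_apply)
qed

text \<open>Since \<open>adj\<close> is a definite description, \<open>adj T = T\<close> says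
  something about \<open>T\<close> only once the adjoint is known to exist and to be unique. From
  here on self-adjointness is used as symmetry of the form.\<close>

lemma self_adjoint_iff:
  "self_adjoint T \<longleftrightarrow>
    T \<in> bounded_ops \<and> (\<forall>x y. cinner (blinfun_apply T x) y = cinner x (blinfun_apply T y))"
proof -
  have uniq: "S = S'" if "\<forall>x y. cinner (T x) y = cinner x (blinfun_apply S y)"
    "\<forall>x y. cinner (T x) y = cinner x (blinfun_apply S' y)" for S S'
  proof (rule blinfun_eqI)
    fix y
    show "blinfun_apply S y = blinfun_apply S' y"
      using that cinner_self_eq_0[of "S y - S' y"] by (simp add: cinner.diff_right)
  qed
  show ?thesis
  proof
    assume sa: "self_adjoint T"
    then obtain S where S: "\<forall>x y. cinner (T x) y = cinner x (blinfun_apply S y)"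
      using adjoint_exists[of T] unfolding self_adjoint_def by metis
    have "adj T = S"
      unfolding adj_def by (rule the_equality) (use S uniq in blast)+
    with sa S show "T \<in> bounded_ops \<and> (\<forall>x y. cinner (T x) y = cinner x (T y))"
      unfolding self_adjoint_def by simp
  next
    assume *: "T \<in> bounded_ops \<and> (\<forall>x y. cinner (T x) y = cinner x (T y))"
    have "adj T = T"
      unfolding adj_def by (rule the_equality) (use * uniq in blast)+
    with * show "self_adjoint T"
      unfolding self_adjoint_def by simp
  qed
qed

subsection \<open>Operators that are small off a finite set\<close>

lemma subspace_orth_compl: "complex_vector.subspace (orth_compl F)"
  unfolding complex_vector.subspace_def orth_compl_def
  by (auto simp: cinner.zero_left cinner_add_left cinner_scaleC_left)

lemma orth_compl_Un: "orth_compl (F \<union> G) = orth_compl F \<inter> orth_compl G"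
  by (auto simp: orth_compl_def)

lemma orth_compl_insert: "orth_compl (insert f F) = {x \<in> orth_compl F. cinner x f = 0}"
  by (auto simp: orth_compl_def)

section \<open>Finite orthonormal systems\<close>

definition orthonormal :: "'a::complex_hilbert_space set \<Rightarrow> bool" where
  "orthonormal E \<longleftrightarrow> (\<forall>e\<in>E. norm e = 1) \<and> (\<forall>e\<in>E. \<forall>e'\<in>E. e \<noteq> e' \<longrightarrow> cinner e e' = 0)"

lemma orthonormal_remainder:
  assumes E: "finite E" "orthonormal E"
  shows "x - (\<Sum>e\<in>E. cinner x e *\<^sub>C e) \<in> orth_compl E"
  unfolding orth_compl_def
proof (intro CollectI ballI)
  fix e' assume e': "e' \<in> E"
  have "cinner (\<Sum>e\<in>E. cinner x e *\<^sub>C e) e' = (\<Sum>e\<in>E. if e = e' then cinner x e' else 0)"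
    unfolding cinner.sum_left
    by (rule sum.cong) (use E e' in \<open>auto simp: cinner_scaleC_left cinner_self orthonormal_def\<close>)
  also have "\<dots> = cinner x e'"
    using E(1) e' by simp
  finally show "cinner (x - (\<Sum>e\<in>E. cinner x e *\<^sub>C e)) e' = 0"
    by (simp add: cinner.diff_left)
qed

text \<open>Bounds that hold off an arbitrary finite set are moved to an orthonormal one, where the
  orthogonal projection is an explicit finite sum. A vector equal to its projection adds nothing to
  the system.\<close>

lemma Gram_Schmidt:
  assumes "finite F"
  obtains E where "finite E" "orthonormal E" "orth_compl E \<subseteq> orth_compl F"
proof -
  have "\<exists>E. finite E \<and> orthonormal E \<and> orth_compl E \<subseteq> orth_compl F"
    using assms
  proof (induction F)
    case empty
    then show ?case
      by (intro exI[of _ "{}"]) (simp add: orthonormal_def)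
  next
    case (insert f F)
    then obtain E where E: "finite E" "orthonormal E" "orth_compl E \<subseteq> orth_compl F"
      by blast
    define p where "p = (\<Sum>e\<in>E. cinner f e *\<^sub>C e)"
    have r: "f - p \<in> orth_compl E"
      unfolding p_def by (rule orthonormal_remainder[OF E(1,2)])
    have p: "cinner x p = 0" if "x \<in> orth_compl E" for x
      using that unfolding p_def cinner.sum_right
      by (intro sum.neutral) (simp add: orth_compl_def cinner_scaleC_right)
    show ?case
    proof (cases "f = p")
      case True
      then have "orth_compl E \<subseteq> orth_compl (insert f F)"
        using E(3) p unfolding orth_compl_insert by blast
      with E show ?thesis
        by blast
    next
      case False
      define e where "e = (1 / norm (f - p)) *\<^sub>R (f - p)"
      have e1: "norm e = 1"
        using False by (simp add: e_def)
      have e0: "cinner e e' = 0" "cinner e' e = 0" if "e' \<in> E" for e'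
        using r that cinner_zero_commute[of e' "f - p"]
        by (auto simp: e_def cinner.scaleR_left cinner.scaleR_right orth_compl_def)
      have "orth_compl (insert e E) \<subseteq> orth_compl (insert f F)"
      proof
        fix x assume x: "x \<in> orth_compl (insert e E)"
        then have xE: "x \<in> orth_compl E" and "cinner x e = 0"
          by (auto simp: orth_compl_insert)
        then have "cinner x (f - p) = 0"
          using False by (simp add: e_def cinner.scaleR_right)
        then have "cinner x f = 0"
          using p[OF xE] by (simp add: cinner.diff_right)
        then show "x \<in> orth_compl (insert f F)"
          using E(3) xE unfolding orth_compl_insert by blast
      qed
      moreover have "orthonormal (insert e E)"
        using E(2) e0 e1 by (auto simp: orthonormal_def)
      ultimately show ?thesis
        using E(1) by blast
    qed
  qed
  then show thesis
    using that by blast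
qed

text \<open>This is the point where infinite dimension enters: some vector lies outside the span of
  the orthonormal system, so its residual can be normalized.\<close>

lemma infinite_dim_unit_vector:
  fixes F :: "'a::complex_hilbert_space set"
  assumes inf: "\<not> (\<exists>B::'a set. finite B \<and> complex_vector.span B = UNIV)"
    and F: "finite F"
  obtains x where "x \<in> orth_compl F" "norm x = 1"
proof -
  obtain E where E: "finite E" "orthonormal E" "orth_compl E \<subseteq> orth_compl F"
    using Gram_Schmidt[OF F] .
  obtain y where y: "y \<notin> complex_vector.span E"
    using inf E(1) by blast
  define r where "r = y - (\<Sum>e\<in>E. cinner y e *\<^sub>C e)"
  have "(\<Sum>e\<in>E. cinner y e *\<^sub>C e) \<in> complex_vector.span E"
    by (rule complex_vector.span_sum, rule complex_vector.span_scale, rule complex_vector.span_base)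
  then have r0: "r \<noteq> 0"
    using y by (auto simp: r_def)
  have "r \<in> orth_compl F"
    using orthonormal_remainder[OF E(1,2)] E(3) unfolding r_def by blast
  then have "(1 / norm r) *\<^sub>R r \<in> orth_compl F"
    using subspace_scale[OF complex_subspace_imp_subspace[OF subspace_orth_compl]] by blast
  then show thesis
    using that[of "(1 / norm r) *\<^sub>R r"] r0 by simp
qed

text \<open>For bounded operators this is equivalent to compactness, but it is much easier to
  propagate through algebraic combinations.\<close>

definition small_off_finite :: "('a::complex_hilbert_space \<Rightarrow>\<^sub>L 'a) \<Rightarrow> bool" where
  "small_off_finite B \<longleftrightarrow>
    (\<forall>\<epsilon>>0. \<exists>F. finite F \<and> (\<forall>x\<in>orth_compl F. norm (blinfun_apply B x) \<le> \<epsilon> * norm x))"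

lemma small_off_finiteE:
  assumes "small_off_finite B" "\<epsilon> > 0"
  obtains F where "finite F" "\<And>x. x \<in> orth_compl F \<Longrightarrow> norm (blinfun_apply B x) \<le> \<epsilon> * norm x"
proof -
  have "\<exists>F. finite F \<and> (\<forall>x\<in>orth_compl F. norm (blinfun_apply B x) \<le> \<epsilon> * norm x)"
    using assms by (simp add: small_off_finite_def)
  then show thesis
    using that by blast
qed

text \<open>The property travels by pointwise norm bounds: from T^2 - \<alpha>^2 to |T| - \<alpha>,
  and from there to the two compact summands.\<close>

lemma small_off_finite_dominated:
  assumes B: "small_off_finite B"
    and le: "\<And>x. norm (blinfun_apply C x) \<le> c * norm (blinfun_apply B x)"
  shows "small_off_finite C"
  unfolding small_off_finite_def
proof (intro allI impI)
  fix \<epsilon> :: real assume \<epsilon>: "\<epsilon> > 0"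
  \<comment> \<open>The constant \<open>c\<close> may be zero or negative, so it is replaced by a
    positive upper bound before dividing.\<close>
  have c: "\<bar>c\<bar> + 1 > 0"
    by simp
  with \<epsilon> have \<epsilon>': "\<epsilon> / (\<bar>c\<bar> + 1) > 0"
    by simp
  obtain F where F: "finite F"
    "\<And>x. x \<in> orth_compl F \<Longrightarrow> norm (B x) \<le> \<epsilon> / (\<bar>c\<bar> + 1) * norm x"
    using small_off_finiteE[OF B \<epsilon>'] by blast
  have "norm (C x) \<le> \<epsilon> * norm x" if "x \<in> orth_compl F" for x
  proof -
    have "norm (C x) \<le> (\<bar>c\<bar> + 1) * norm (B x)"
      by (rule order_trans[OF le mult_right_mono]) auto
    also have "\<dots> \<le> (\<bar>c\<bar> + 1) * (\<epsilon> / (\<bar>c\<bar> + 1) * norm x)"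
      using F(2)[OF that] c by (intro mult_left_mono) auto
    also have "\<dots> = \<epsilon> * norm x"
      using c by simp
    finally show ?thesis .
  qed
  with F(1) show "\<exists>F. finite F \<and> (\<forall>x\<in>orth_compl F. norm (C x) \<le> \<epsilon> * norm x)"
    by (intro exI[of _ F]) simp
qed

text \<open>By induction the combinations lie in a sum of compact images of the unit disc. This
  plays the role of the Heine-Borel theorem for the span of \<open>E\<close>, with coordinates in
  place of norms.\<close>

lemma compact_bounded_combinations:
  fixes E :: "'a::complex_hilbert_space set"
  assumes "finite E"
  shows "\<exists>K. compact K \<and> (\<forall>c. (\<forall>e\<in>E. cmod (c e) \<le> 1) \<longrightarrow> (\<Sum>e\<in>E. c e *\<^sub>C e) \<in> K)"
  using assms
proof (induction E)
  case empty
  then show ?case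
    by (intro exI[of _ "{0}"]) simp
next
  case (insert e E)
  then obtain K where K: "compact K"
    "\<And>c. (\<forall>e\<in>E. cmod (c e) \<le> 1) \<Longrightarrow> (\<Sum>e\<in>E. c e *\<^sub>C e) \<in> K"
    by blast
  have "bounded_linear (\<lambda>z. z *\<^sub>C e)"
    by (rule bounded_linear_intro[where K = "norm e"])
      (auto simp: scaleC_add_left scaleR_scaleC scaleC_scaleC norm_scaleC scaleR_conv_of_real)
  then have "compact ((\<lambda>z. z *\<^sub>C e) ` cball 0 1)"
    by (intro compact_continuous_image linear_continuous_on compact_cball)
  then have "compact {x + y | x y. x \<in> (\<lambda>z. z *\<^sub>C e) ` cball 0 1 \<and> y \<in> K}"
    using K(1) by (rule compact_sums)
  then show ?case
  proof (intro exI conjI allI impI)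
    fix c assume c: "\<forall>e'\<in>insert e E. cmod (c e') \<le> 1"
    then have "(\<Sum>e\<in>E. c e *\<^sub>C e) \<in> K" "c e *\<^sub>C e \<in> (\<lambda>z. z *\<^sub>C e) ` cball 0 1"
      by (auto intro: K(2))
    then show "(\<Sum>e\<in>insert e E. c e *\<^sub>C e) \<in> {x + y | x y. x \<in> (\<lambda>z. z *\<^sub>C e) ` cball 0 1 \<and> y \<in> K}"
      unfolding sum.insert[OF insert.hyps] by blast
  qed
qed

text \<open>Split \<open>x\<close> into its projection onto a finite orthonormal system and a
  remainder. The projections of the unit ball lie in a compact set, so finitely many balls of radius
  \<epsilon>/3 cover their images; the remainder moves the image by at most another
  \<epsilon>/3.\<close>

lemma small_off_finite_imp_compact_op:
  assumes B: "B \<in> bounded_ops" "small_off_finite B"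
  shows "compact_op B"
proof -
  let ?A = "blinfun_apply B ` cball 0 1"
  have cover: "\<exists>k. finite k \<and> closure ?A \<subseteq> (\<Union>x\<in>k. ball x \<epsilon>)" if \<epsilon>: "\<epsilon> > 0" for \<epsilon>
  proof -
    have \<epsilon>3: "\<epsilon> / 3 > 0"
      using \<epsilon> by simp
    obtain F where F: "finite F" "\<And>x. x \<in> orth_compl F \<Longrightarrow> norm (B x) \<le> \<epsilon> / 3 * norm x"
      using small_off_finiteE[OF B(2) \<epsilon>3] by blast
    obtain E where E: "finite E" "orthonormal E" "orth_compl E \<subseteq> orth_compl F"
      using Gram_Schmidt[OF F(1)] .
    obtain K where K: "compact K"
      "\<And>c. (\<forall>e\<in>E. cmod (c e) \<le> 1) \<Longrightarrow> (\<Sum>e\<in>E. c e *\<^sub>C e) \<in> K"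
      using compact_bounded_combinations[OF E(1)] by blast
    have "compact (blinfun_apply B ` K)"
      by (intro compact_continuous_image K(1) blinfun.continuous_on continuous_on_const continuous_on_id)
    then obtain k where k: "finite k" "blinfun_apply B ` K \<subseteq> (\<Union>x\<in>k. ball x (\<epsilon>/3))"
      using \<epsilon>3 unfolding compact_eq_totally_bounded by blast
    \<comment> \<open>A finite union of closed balls also contains the closure of the image; the
      radius stays below \<epsilon> so that open balls can be restored afterwards.\<close>
    have "?A \<subseteq> (\<Union>x\<in>k. cball x (2 * \<epsilon> / 3))"
    proof
      fix z assume "z \<in> ?A"
      then obtain x where x: "norm x \<le> 1" and z: "z = B x"
        by auto
      define p where "p = (\<Sum>e\<in>E. cinner x e *\<^sub>C e)"
      have "cmod (cinner x e) \<le> 1" if "e \<in> E" for e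
        using norm_cinner_le[of x e] x that E(2) by (simp add: orthonormal_def)
      then have "p \<in> K"
        unfolding p_def by (intro K(2)) blast
      then obtain q where q: "q \<in> k" "dist q (B p) < \<epsilon> / 3"
        using k(2) by auto
      have r: "x - p \<in> orth_compl E"
        unfolding p_def by (rule orthonormal_remainder[OF E(1,2)])
      then have "cinner (x - p) p = 0"
        unfolding p_def cinner.sum_right
        by (intro sum.neutral) (simp add: orth_compl_def cinner_scaleC_right)
      then have "(norm (x - p))\<^sup>2 \<le> (norm x)\<^sup>2"
        using norm_add_squared[of "x - p" p] by simp
      then have "norm (x - p) \<le> 1"
        using x by (meson norm_ge_zero order_trans power2_le_imp_le)
      moreover have "norm (B (x - p)) \<le> \<epsilon> / 3 * norm (x - p)"
        using F(2) E(3) r by blast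
      ultimately have "norm (B (x - p)) \<le> \<epsilon> / 3"
        using \<epsilon> by (smt (verit, ccfv_SIG) \<epsilon>3 mult_left_le)
      then have "dist (B p) z \<le> \<epsilon> / 3"
        by (simp add: z dist_norm blinfun.diff_right norm_minus_commute)
      then have "dist q z \<le> 2 * \<epsilon> / 3"
        using q(2) dist_triangle[of q z "B p"] by simp
      with q(1) show "z \<in> (\<Union>x\<in>k. cball x (2 * \<epsilon> / 3))"
        by auto
    qed
    then have "closure ?A \<subseteq> (\<Union>x\<in>k. cball x (2 * \<epsilon> / 3))"
      using k(1) by (intro closure_minimal closed_UN) auto
    also have "\<dots> \<subseteq> (\<Union>x\<in>k. ball x \<epsilon>)"
      using \<epsilon> by (intro UN_mono) (auto simp: subset_eq)
    finally show ?thesis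
      using k(1) by blast
  qed
  have "compact (closure ?A)"
    unfolding compact_eq_totally_bounded using cover by (simp add: complete_eq_closed)
  with B(1) show ?thesis
    unfolding compact_op_def by simp
qed

subsection \<open>Absolutely norm attaining operators\<close>

text \<open>The intermediate value theorem on the segment from \<open>x\<close> to \<open>y\<close>
  is applied to the homogeneous function \<open>norm (S z) - t * norm z\<close>, so normalization
  can wait. The segment misses the origin, because opposite unit vectors have images of equal
  norm.\<close>

lemma norm_attains_intermediate:
  fixes S :: "'a::complex_hilbert_space \<Rightarrow>\<^sub>L 'a"
  assumes V: "subspace V"
    and x: "x \<in> V" "norm x = 1" "norm (S x) < t"
    and y: "y \<in> V" "norm y = 1" "t < norm (S y)"
  obtains g where "g \<in> V" "norm g = 1" "norm (S g) = t"
proof -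
  define z where "z s = (1 - s) *\<^sub>R x + s *\<^sub>R y" for s :: real
  have "continuous_on {0..1} (\<lambda>s. norm (S (z s)) - t * norm (z s))"
    unfolding z_def by (intro continuous_intros)
  moreover have "norm (S (z 0)) - t * norm (z 0) \<le> 0" "0 \<le> norm (S (z 1)) - t * norm (z 1)"
    using x y by (auto simp: z_def)
  ultimately obtain s where s: "0 \<le> s" "s \<le> 1" "norm (S (z s)) - t * norm (z s) = 0"
    using IVT'[of "\<lambda>s. norm (S (z s)) - t * norm (z s)" 0 0 1] by auto
  have "z s \<noteq> 0"
  proof
    assume "z s = 0"
    then have *: "(1 - s) *\<^sub>R x = - (s *\<^sub>R y)"
      unfolding z_def using add_eq_0_iff2 by blast
    then have "norm ((1 - s) *\<^sub>R x) = norm (s *\<^sub>R y)"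
      by simp
    then have "s = 1/2"
      using s x y by simp
    with * have "x = - y"
      by (simp flip: scaleR_minus_right)
    with x y show False
      by (simp add: blinfun.minus_right)
  qed
  moreover have "z s \<in> V"
    unfolding z_def using V x(1) y(1) by (simp add: subspace_add subspace_scale)
  ultimately show thesis
    using that[of "(1 / norm (z s)) *\<^sub>R z s"] V s(3)
    by (simp add: subspace_scale blinfun.scaleR_right)
qed

lemma norm_sum_orthogonal_squared:
  fixes v :: "'i \<Rightarrow> 'a::complex_hilbert_space"
  assumes "finite I" "\<And>i j. i \<in> I \<Longrightarrow> j \<in> I \<Longrightarrow> i \<noteq> j \<Longrightarrow> cinner (v i) (v j) = 0"
  shows "(norm (\<Sum>i\<in>I. v i))\<^sup>2 = (\<Sum>i\<in>I. (norm (v i))\<^sup>2)"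
  using assms
proof (induction I)
  case (insert i I)
  have "cinner (v i) (\<Sum>j\<in>I. v j) = 0"
    unfolding cinner.sum_right using insert by (intro sum.neutral) auto
  with insert show ?case
    by (simp add: norm_add_squared)
qed simp

lemma closure_complex_subspace:
  fixes V :: "'a::complex_hilbert_space set"
  assumes V: "complex_vector.subspace V"
  shows "complex_vector.subspace (closure V)"
  unfolding complex_vector.subspace_def
proof (intro conjI ballI allI)
  show "0 \<in> closure V"
    using complex_vector.subspace_0[OF V] closure_subset by blast
next
  fix x y assume "x \<in> closure V" "y \<in> closure V"
  then obtain f g where fg: "\<And>n. f n \<in> V" "f \<longlonglongrightarrow> x" "\<And>n. g n \<in> V" "g \<longlonglongrightarrow> y"
    unfolding closure_sequential by blast
  then have "(\<lambda>n. f n + g n) \<longlonglongrightarrow> x + y" "\<And>n. f n + g n \<in> V"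
    using complex_vector.subspace_add[OF V] by (auto intro: tendsto_add)
  then show "x + y \<in> closure V"
    unfolding closure_sequential by (intro exI[of _ "\<lambda>n. f n + g n"]) simp
next
  fix c x assume "x \<in> closure V"
  then obtain f where f: "\<And>n. f n \<in> V" "f \<longlonglongrightarrow> x"
    unfolding closure_sequential by blast
  then have "(\<lambda>n. c *\<^sub>C f n) \<longlonglongrightarrow> c *\<^sub>C x" "\<And>n. c *\<^sub>C f n \<in> V"
    using complex_vector.subspace_scale[OF V] bounded_linear.tendsto[OF bounded_linear_scaleC]
    by auto
  then show "c *\<^sub>C x \<in> closure V"
    unfolding closure_sequential by (intro exI[of _ "\<lambda>n. c *\<^sub>C f n"]) simp
qed

lemma norm_le_norm_on:
  assumes "x \<in> M" "norm x \<le> 1"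
  shows "norm (blinfun_apply S x) \<le> norm_on M S"
  unfolding norm_on_def
proof (rule cSUP_upper)
  show "bdd_above ((\<lambda>x. norm (blinfun_apply S x)) ` {x \<in> M. norm x \<le> 1})"
    by (rule bdd_aboveI[of _ "norm S"]) (auto intro!: order_trans[OF norm_blinfun] mult_left_le)
qed (use assms in simp)

text \<open>On the span of \<open>g\<close> the defect
  \<open>b^2 * (norm y)^2 - (norm (S y))^2\<close> is the sum of the nonnegative terms
  \<open>(b^2 - (norm (S (g i)))^2) * |c_i|^2\<close>, where \<open>c_i\<close> are the coefficients
  of \<open>y\<close>. A unit vector of the closed span attaining the norm has defect at most 0, so
  it is orthogonal to every \<open>g n\<close>, hence to itself.\<close>

lemma orthogonal_increasing_not_AN:
  fixes S :: "'a::complex_hilbert_space \<Rightarrow>\<^sub>L 'a"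
  assumes S: "S \<in> bounded_ops"
    and g: "\<And>n. norm (g n) = 1" "\<And>m n. m \<noteq> n \<Longrightarrow> cinner (g m) (g n) = 0"
    and Sg: "\<And>m n. m \<noteq> n \<Longrightarrow> cinner (S (g m)) (S (g n)) = 0"
    and incr: "\<And>n::nat. norm (S (g n)) < b" "(\<lambda>n. norm (S (g n))) \<longlonglongrightarrow> b"
  shows "S \<notin> AN_ops"
proof
  assume AN: "S \<in> AN_ops"
  define M where "M = closure (complex_vector.span (range g))"
  have M: "complex_vector.subspace M" "closed M"
    unfolding M_def by (auto intro: closure_complex_subspace complex_vector.subspace_span)
  have gM: "g n \<in> M" for n
    unfolding M_def using complex_vector.span_base[of "g n" "range g"] closure_subset by blast
  moreover have "g 0 \<noteq> 0"
    using g(1)[of 0] by auto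
  ultimately have "norm_attaining_on M S"
    using AN M unfolding AN_ops_def by blast
  then obtain x where x: "x \<in> M" "norm x = 1" "norm (S x) = norm_on M S"
    unfolding norm_attaining_on_def by blast
  have b0: "b \<ge> 0"
    using incr(1)[of 0] norm_ge_zero[of "S (g 0)"] by linarith
  \<comment> \<open>Keeping a single term of the sum gives an inequality between continuous
    functions of \<open>y\<close>, which passes to the closure without any series expansion.\<close>
  have key: "(b\<^sup>2 - (norm (S (g n)))\<^sup>2) * (cmod (cinner y (g n)))\<^sup>2 \<le> b\<^sup>2 * (norm y)\<^sup>2 - (norm (S y))\<^sup>2"
    if "y \<in> M" for y n
  proof -
    let ?R = "{y. (b\<^sup>2 - (norm (S (g n)))\<^sup>2) * (cmod (cinner y (g n)))\<^sup>2 \<le> b\<^sup>2 * (norm y)\<^sup>2 - (norm (S y))\<^sup>2}"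
    have inj: "inj g"
    proof (rule injI, rule ccontr)
      fix m k assume "g m = g k" "m \<noteq> k"
      then have "cinner (g m) (g m) = 0"
        using g(2)[of m k] by simp
      then show False
        using g(1)[of m] by (simp add: cinner_self)
    qed
    have "complex_vector.span (range g) \<subseteq> ?R"
    proof
      fix y assume "y \<in> complex_vector.span (range g)"
      then obtain t r where t: "finite t" "t \<subseteq> range g" "y = (\<Sum>a\<in>t. r a *\<^sub>C a)"
        unfolding complex_vector.span_explicit by blast
      then obtain I where I: "finite I" "t = g ` I"
        using finite_subset_image[of t g UNIV] by blast
      define c where "c i = r (g i)" for i
      have y: "y = (\<Sum>i\<in>I. c i *\<^sub>C g i)"
        unfolding t(3) I(2) c_def using inj by (simp add: sum.reindex inj_on_def)
      have ny: "(norm y)\<^sup>2 = (\<Sum>i\<in>I. (cmod (c i))\<^sup>2)"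
        unfolding y using g(2) I(1)
        by (subst norm_sum_orthogonal_squared)
          (auto simp: norm_scaleC g(1) cinner_scaleC_left cinner_scaleC_right)
      have "S y = (\<Sum>i\<in>I. c i *\<^sub>C S (g i))"
        unfolding y by (simp add: blinfun.sum_right bounded_opsD[OF S])
      then have nSy: "(norm (S y))\<^sup>2 = (\<Sum>i\<in>I. (cmod (c i))\<^sup>2 * (norm (S (g i)))\<^sup>2)"
        using Sg I(1)
        by (simp, subst norm_sum_orthogonal_squared)
          (auto simp: norm_scaleC cinner_scaleC_left cinner_scaleC_right power_mult_distrib)
      have diff: "b\<^sup>2 * (norm y)\<^sup>2 - (norm (S y))\<^sup>2 = (\<Sum>i\<in>I. (b\<^sup>2 - (norm (S (g i)))\<^sup>2) * (cmod (c i))\<^sup>2)"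
        unfolding ny nSy by (simp add: sum_distrib_left sum_subtractf algebra_simps)
      have nonneg: "0 \<le> (b\<^sup>2 - (norm (S (g i)))\<^sup>2) * (cmod (c i))\<^sup>2" for i
        using incr(1)[of i] by (intro mult_nonneg_nonneg) (auto intro: power_mono)
      have cin: "cinner y (g n) = (\<Sum>i\<in>I. if i = n then c n else 0)"
        unfolding y cinner.sum_left
        by (rule sum.cong) (use g in \<open>auto simp: cinner_scaleC_left cinner_self\<close>)
      show "y \<in> ?R"
      proof (cases "n \<in> I")
        case True
        then have "cinner y (g n) = c n"
          using cin I(1) by simp
        then show ?thesis
          unfolding mem_Collect_eq diff using True I(1) nonneg
          by (simp add: member_le_sum[of n I "\<lambda>i. (b\<^sup>2 - (norm (S (g i)))\<^sup>2) * (cmod (c i))\<^sup>2"])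
      next
        case False
        then have "cinner y (g n) = 0"
          using cin I(1) by simp
        then show ?thesis
          unfolding mem_Collect_eq diff using nonneg by (simp add: sum_nonneg)
      qed
    qed
    moreover have "closed ?R"
      by (intro closed_Collect_le continuous_intros cinner.continuous_on)
    ultimately have "M \<subseteq> ?R"
      unfolding M_def by (rule closure_minimal)
    then show ?thesis
      using that by blast
  qed
  have "b \<le> norm_on M S"
    by (rule LIMSEQ_le_const2[OF incr(2)]) (simp add: norm_le_norm_on gM g(1))
  then have "b\<^sup>2 \<le> (norm (S x))\<^sup>2"
    using x(3) b0 by (simp add: power_mono)
  note b_le = this
  have orth: "cinner x (g n) = 0" for n
  proof -
    have "(b\<^sup>2 - (norm (S (g n)))\<^sup>2) * (cmod (cinner x (g n)))\<^sup>2 \<le> 0"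
      using key[OF x(1), of n] b_le x(2) by simp
    moreover have "b\<^sup>2 - (norm (S (g n)))\<^sup>2 > 0"
      using incr(1)[of n] by (simp add: power_strict_mono)
    ultimately have "(cmod (cinner x (g n)))\<^sup>2 \<le> 0"
      by (simp add: mult_le_0_iff)
    then show ?thesis
      by simp
  qed
  have "closed {y. cinner x y = 0}"
    by (intro closed_Collect_eq continuous_intros cinner.continuous_on)
  moreover have "complex_vector.span (range g) \<subseteq> {y. cinner x y = 0}"
    by (rule complex_vector.span_minimal)
      (auto simp: orth complex_vector.subspace_def cinner.zero_right
        cinner_add_right cinner_scaleC_right)
  ultimately have "M \<subseteq> {y. cinner x y = 0}"
    unfolding M_def by (intro closure_minimal)
  then have "cinner x x = 0"
    using x(1) by blast
  then show False
    using x(2) by (simp add: cinner_self)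
qed

text \<open>If neither alternative held, the values of \<^term>\<open>norm (S x)\<close> on unit vectors orthogonal to
  a finite set would always fill the interval; choosing \<open>g n\<close> orthogonal to the earlier \<open>g i\<close> and
  \<open>S* S g i\<close> then yields a subspace on which the norm is not attained.\<close>

lemma AN_gap:
  fixes S :: "'a::complex_hilbert_space \<Rightarrow>\<^sub>L 'a"
  assumes AN: "S \<in> AN_ops" and "a < b"
  shows "\<exists>F. finite F \<and> ((\<forall>x\<in>orth_compl F. norm x = 1 \<longrightarrow> a < norm (S x)) \<or>
    (\<forall>x\<in>orth_compl F. norm x = 1 \<longrightarrow> norm (S x) < b))"
proof (rule ccontr)
  assume neg: "\<not> ?thesis"
  have S: "S \<in> bounded_ops"
    using AN by (simp add: AN_ops_def)
  obtain S' :: "'a \<Rightarrow>\<^sub>L 'a" where S': "\<And>x y. cinner (S x) y = cinner x (S' y)"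
    using adjoint_exists[OF S] by blast
  have fill: "\<exists>g. g \<in> orth_compl F \<and> norm g = 1 \<and> norm (S g) = t"
    if "finite F" "a < t" "t < b" for F t
  proof -
    obtain x y where "x \<in> orth_compl F" "norm x = 1" "norm (S x) \<le> a"
      "y \<in> orth_compl F" "norm y = 1" "b \<le> norm (S y)"
      using neg \<open>finite F\<close> by (meson linorder_not_le)
    then show ?thesis
      using norm_attains_intermediate[OF complex_subspace_imp_subspace[OF subspace_orth_compl[of F]], of x S t y]
        that by (metis le_less_trans less_le_trans)
  qed
  \<comment> \<open>With \<open>n + 1\<close> in place of \<open>n + 2\<close> the first value would
    be \<open>a\<close> itself, where \<open>fill\<close> does not apply.\<close>
  define t where "t n = b - (b - a) / real (n + 2)" for n
  have t: "a < t n" "t n < b" for n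
  proof -
    have "(b - a) / real (n + 2) < (b - a) / 1"
      using \<open>a < b\<close> by (intro divide_strict_left_mono) auto
    then show "a < t n" "t n < b"
      using \<open>a < b\<close> by (simp_all add: t_def)
  qed
  have "\<exists>g. \<forall>n. g n \<in> orth_compl (g ` {..<n} \<union> (\<lambda>i. S' (S (g i))) ` {..<n}) \<and>
      norm (g n) = 1 \<and> norm (S (g n)) = t n"
    by (rule dependent_wf_choice[OF wf_less_than]) (use fill t in \<open>auto cong: image_cong_simp\<close>)
  then obtain g where g: "\<And>n. g n \<in> orth_compl (g ` {..<n} \<union> (\<lambda>i. S' (S (g i))) ` {..<n})"
    "\<And>n. norm (g n) = 1" "\<And>n. norm (S (g n)) = t n"
    by blast
  have lt: "cinner (g n) (g m) = 0" "cinner (S (g n)) (S (g m)) = 0" if "m < n" for m n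
    using g(1)[of n] that by (auto simp: orth_compl_def S')
  have "S \<notin> AN_ops"
  proof (rule orthogonal_increasing_not_AN[OF S g(2)])
    show "cinner (g m) (g n) = 0" "cinner (S (g m)) (S (g n)) = 0" if "m \<noteq> n" for m n
      using lt[of m n] lt[of n m] that cinner_zero_commute
      by (metis linorder_neqE_nat)+
    show "norm (S (g n)) < b" for n
      using g(3) t by simp
    have "(\<lambda>n. (b - a) / real (n + 2)) \<longlonglongrightarrow> 0"
      using LIMSEQ_ignore_initial_segment[OF lim_const_over_n[of "b - a"], of 2] by simp
    then show "(\<lambda>n. norm (S (g n))) \<longlonglongrightarrow> b"
      unfolding g(3) t_def using tendsto_diff[OF tendsto_const] by fastforce
  qed
  with AN show False
    by blast
qed

text \<open>An approximant within a third of the gap satisfies the dichotomy for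
  \<open>a + d < b - d\<close>, and replacing it by \<open>T\<close> costs \<open>d\<close> on
  either side.\<close>

lemma closure_AN_gap:
  fixes T :: "'a::complex_hilbert_space \<Rightarrow>\<^sub>L 'a"
  assumes T: "T \<in> closure AN_ops" and "a < b"
  shows "\<exists>F. finite F \<and> ((\<forall>x\<in>orth_compl F. norm x = 1 \<longrightarrow> a < norm (T x)) \<or>
    (\<forall>x\<in>orth_compl F. norm x = 1 \<longrightarrow> norm (T x) < b))"
proof -
  define d where "d = (b - a) / 3"
  have d: "d > 0" "a + d < b - d"
    using \<open>a < b\<close> by (auto simp: d_def field_simps)
  obtain S where S: "S \<in> AN_ops" "dist S T < d"
    using T d(1) unfolding closure_approachable by blast
  have near: "\<bar>norm (S x) - norm (T x)\<bar> < d" if "norm x = 1" for x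
  proof -
    have "norm ((S - T) x) \<le> norm (S - T)"
      using norm_blinfun[of "S - T" x] that by simp
    then show ?thesis
      using S(2) norm_triangle_ineq3[of "S x" "T x"] by (simp add: dist_norm minus_blinfun.rep_eq)
  qed
  obtain F where F: "finite F"
    "(\<forall>x\<in>orth_compl F. norm x = 1 \<longrightarrow> a + d < norm (S x)) \<or>
     (\<forall>x\<in>orth_compl F. norm x = 1 \<longrightarrow> norm (S x) < b - d)"
    using AN_gap[OF S(1) d(2)] by blast
  from F(2) have "(\<forall>x\<in>orth_compl F. norm x = 1 \<longrightarrow> a < norm (T x)) \<or>
    (\<forall>x\<in>orth_compl F. norm x = 1 \<longrightarrow> norm (T x) < b)"
  proof (rule disj_forward)
    assume *: "\<forall>x\<in>orth_compl F. norm x = 1 \<longrightarrow> a + d < norm (S x)"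
    show "\<forall>x\<in>orth_compl F. norm x = 1 \<longrightarrow> a < norm (T x)"
    proof (intro ballI impI)
      fix x assume "x \<in> orth_compl F" "norm x = 1"
      then show "a < norm (T x)"
        using *[rule_format, of x] near[of x] by linarith
    qed
  next
    assume *: "\<forall>x\<in>orth_compl F. norm x = 1 \<longrightarrow> norm (S x) < b - d"
    show "\<forall>x\<in>orth_compl F. norm x = 1 \<longrightarrow> norm (T x) < b"
    proof (intro ballI impI)
      fix x assume "x \<in> orth_compl F" "norm x = 1"
      then show "norm (T x) < b"
        using *[rule_format, of x] near[of x] by linarith
    qed
  qed
  with F(1) show ?thesis
    by blast
qed

text \<open>The number \<alpha> is the supremum of the strict lower bounds that hold off finite
  sets. This gives the estimate from below; for the one from above, a number larger than \<alpha> is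
  no such bound, which rules out one alternative of \<open>closure_AN_gap\<close>.\<close>

lemma closure_AN_essential_norm:
  fixes T :: "'a::complex_hilbert_space \<Rightarrow>\<^sub>L 'a"
  assumes inf: "\<not> (\<exists>B::'a set. finite B \<and> complex_vector.span B = UNIV)"
    and T: "T \<in> closure AN_ops"
  obtains \<alpha> where "\<alpha> \<ge> 0"
    "\<And>\<epsilon>. \<epsilon> > 0 \<Longrightarrow> \<exists>F. finite F \<and> (\<forall>x\<in>orth_compl F. norm x = 1 \<longrightarrow> \<bar>norm (T x) - \<alpha>\<bar> < \<epsilon>)"
proof -
  define A where "A = {a. \<exists>F. finite F \<and> (\<forall>x\<in>orth_compl F. norm x = 1 \<longrightarrow> a < norm (T x))}"
  have neg: "a \<in> A" if "a < 0" for a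
  proof -
    have "a < norm (T x)" for x
      using that norm_ge_zero[of "T x"] by linarith
    then show ?thesis
      unfolding A_def by (intro CollectI exI[of _ "{}"]) simp
  qed
  have bdd: "bdd_above A"
  proof (rule bdd_aboveI[of _ "norm T"])
    fix a assume "a \<in> A"
    then obtain F where F: "finite F" "\<And>x. x \<in> orth_compl F \<Longrightarrow> norm x = 1 \<Longrightarrow> a < norm (T x)"
      unfolding A_def by blast
    obtain x where "x \<in> orth_compl F" "norm x = 1"
      using infinite_dim_unit_vector[OF inf F(1)] .
    then show "a \<le> norm T"
      using F(2)[of x] norm_blinfun[of T x] by simp
  qed
  define \<alpha> where "\<alpha> = Sup A"
  have upper: "a \<le> \<alpha>" if "a \<in> A" for a
    unfolding \<alpha>_def by (rule cSup_upper[OF that bdd])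
  have "\<alpha> \<ge> 0"
  proof (rule ccontr)
    assume "\<not> \<alpha> \<ge> 0"
    then show False
      using upper[OF neg[of "\<alpha> / 2"]] by simp
  qed
  moreover have "\<exists>F. finite F \<and> (\<forall>x\<in>orth_compl F. norm x = 1 \<longrightarrow> \<bar>norm (T x) - \<alpha>\<bar> < \<epsilon>)"
    if \<epsilon>: "\<epsilon> > 0" for \<epsilon>
  proof -
    have "A \<noteq> {}"
      using neg[of "-1"] by auto
    then obtain a where a: "a \<in> A" "\<alpha> - \<epsilon> < a"
      using less_cSupE[of "\<alpha> - \<epsilon>" A] \<epsilon> by (auto simp: \<alpha>_def)
    then obtain F where F: "finite F" "\<And>x. x \<in> orth_compl F \<Longrightarrow> norm x = 1 \<Longrightarrow> a < norm (T x)"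
      unfolding A_def by blast
    \<comment> \<open>The lower end is placed strictly above \<alpha>, since \<alpha> itself might
      belong to \<open>A\<close>.\<close>
    have "\<alpha> + \<epsilon> / 2 < \<alpha> + \<epsilon>"
      using \<epsilon> by simp
    from closure_AN_gap[OF T this] obtain G where G: "finite G"
      "(\<forall>x\<in>orth_compl G. norm x = 1 \<longrightarrow> \<alpha> + \<epsilon> / 2 < norm (T x)) \<or>
       (\<forall>x\<in>orth_compl G. norm x = 1 \<longrightarrow> norm (T x) < \<alpha> + \<epsilon>)"
      by blast
    have "\<alpha> + \<epsilon> / 2 \<notin> A"
      using upper[of "\<alpha> + \<epsilon> / 2"] \<epsilon> by auto
    with G have G2: "norm (T x) < \<alpha> + \<epsilon>" if "x \<in> orth_compl G" "norm x = 1" for x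
      using that unfolding A_def by blast
    have "\<bar>norm (T x) - \<alpha>\<bar> < \<epsilon>" if "x \<in> orth_compl (F \<union> G)" "norm x = 1" for x
      using F(2)[of x] G2[of x] a(2) that by (simp add: orth_compl_Un)
    with F(1) G(1) show ?thesis
      by (intro exI[of _ "F \<union> G"]) simp
  qed
  ultimately show thesis
    by (rule that)
qed

subsection \<open>Positive operators and square roots\<close>

lemma self_adjoint_bounded_ops: "self_adjoint T \<Longrightarrow> T \<in> bounded_ops"
  by (simp add: self_adjoint_iff)

lemma self_adjointD: "self_adjoint T \<Longrightarrow> cinner (blinfun_apply T x) y = cinner x (blinfun_apply T y)"
  by (simp add: self_adjoint_iff)

lemma self_adjointI:
  assumes "T \<in> bounded_ops" "\<And>x y. cinner (blinfun_apply T x) y = cinner x (blinfun_apply T y)"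
  shows "self_adjoint T"
  using assms by (simp add: self_adjoint_iff)

lemma self_adjoint_id: "self_adjoint id_blinfun"
  by (simp add: self_adjoint_iff bounded_ops_def)

lemma bounded_ops_compose: "S \<in> bounded_ops \<Longrightarrow> T \<in> bounded_ops \<Longrightarrow> S o\<^sub>L T \<in> bounded_ops"
  by (simp add: bounded_ops_def)

lemma self_adjoint_add: "self_adjoint S \<Longrightarrow> self_adjoint T \<Longrightarrow> self_adjoint (S + T)"
  by (simp add: self_adjoint_iff bounded_ops_def blinfun.add_left scaleC_add_right
      cinner.add_left cinner.add_right)

lemma self_adjoint_scaleR: "self_adjoint T \<Longrightarrow> self_adjoint (r *\<^sub>R T)"
  by (simp add: self_adjoint_iff bounded_ops_def blinfun.scaleR_left scaleR_scaleC scaleC_scaleC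
      mult.commute cinner_scaleC_left cinner_scaleC_right)

lemma self_adjoint_diff: "self_adjoint S \<Longrightarrow> self_adjoint T \<Longrightarrow> self_adjoint (S - T)"
  using self_adjoint_add[of S "(-1) *\<^sub>R T"] self_adjoint_scaleR[of T "-1"] by simp

lemma self_adjoint_compose_commute:
  assumes S: "self_adjoint S" and T: "self_adjoint T"
    and comm: "\<And>x. blinfun_apply S (blinfun_apply T x) = blinfun_apply T (blinfun_apply S x)"
  shows "self_adjoint (S o\<^sub>L T)"
  by (rule self_adjointI)
    (simp_all add: bounded_ops_compose self_adjoint_bounded_ops S T self_adjointD comm)

lemma bounded_ops_limit:
  assumes R: "\<And>n. R n \<in> bounded_ops" and lim: "R \<longlonglongrightarrow> L"
  shows "L \<in> bounded_ops"
  unfolding bounded_ops_def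
proof (intro CollectI allI)
  fix c x
  have pt: "(\<lambda>n. R n x) \<longlonglongrightarrow> L x" for x
    by (intro tendsto_intros lim)
  have "(\<lambda>n. c *\<^sub>C R n x) \<longlonglongrightarrow> c *\<^sub>C L x"
    by (rule bounded_linear.tendsto[OF bounded_linear_scaleC pt])
  then show "L (c *\<^sub>C x) = c *\<^sub>C L x"
    using pt[of "c *\<^sub>C x"] LIMSEQ_unique by (simp add: bounded_opsD[OF R]) blast
qed

lemma self_adjoint_limit:
  assumes R: "\<And>n. self_adjoint (R n)" and lim: "R \<longlonglongrightarrow> L"
  shows "self_adjoint L"
proof (rule self_adjointI)
  show "L \<in> bounded_ops"
    using bounded_ops_limit[OF self_adjoint_bounded_ops[OF R] lim] .
  fix x y
  have "(\<lambda>n. cinner (R n x) y) \<longlonglongrightarrow> cinner (L x) y" "(\<lambda>n. cinner x (R n y)) \<longlonglongrightarrow> cinner x (L y)"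
    by (intro cinner.tendsto blinfun.tendsto tendsto_const lim)+
  then show "cinner (L x) y = cinner x (L y)"
    unfolding self_adjointD[OF R] by (rule LIMSEQ_unique)
qed

lemma positive_opD:
  assumes "positive_op A"
  shows "self_adjoint A" "0 \<le> Re (cinner (blinfun_apply A x) x)"
  using assms by (auto simp: positive_op_def)

lemma positive_op_square: "self_adjoint T \<Longrightarrow> positive_op (T o\<^sub>L T)"
  by (simp add: positive_op_def self_adjoint_compose_commute self_adjointD[of T "T _"] cinner_self
      flip: self_adjointD)

lemma cinner_square: "self_adjoint T \<Longrightarrow> cinner (blinfun_apply T (blinfun_apply T x)) x =
    complex_of_real ((norm (blinfun_apply T x))\<^sup>2)"
  by (simp add: self_adjointD[of T "T x"] cinner_self)

text \<open>This is A^2 \<le> c A, obtained without a square root of \<open>A\<close>: expand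
  positivity at \<open>c *\<^sub>R x - A x\<close> and estimate the term cubic in \<open>A\<close>
  through the norm. It shows that zeros of the form are zeros of \<open>A\<close>, and with
  \<open>c = 1\<close> that 1 - A is a contraction.\<close>

lemma positive_op_norm_squared_le:
  assumes A: "positive_op A" and c: "norm A \<le> c" "c > 0"
  shows "(norm (blinfun_apply A x))\<^sup>2 \<le> c * Re (cinner (blinfun_apply A x) x)"
proof -
  note sa = positive_opD(1)[OF A]
  define y where "y = A x"
  have "Re (cinner (A y) y) \<le> norm (A y) * norm y"
    using norm_cinner_le complex_Re_le_cmod order_trans by blast
  also have "\<dots> \<le> (c * norm y) * norm y"
    using c(1) by (intro mult_right_mono order_trans[OF norm_blinfun]) auto
  finally have 1: "Re (cinner (A y) y) \<le> c * (norm y)\<^sup>2"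
    by (simp add: power2_eq_square mult.assoc)
  have "0 \<le> Re (cinner (A (c *\<^sub>R x - y)) (c *\<^sub>R x - y))"
    by (rule positive_opD(2)[OF A])
  also have "\<dots> = c\<^sup>2 * Re (cinner (A x) x) - 2 * c * (norm y)\<^sup>2 + Re (cinner (A y) y)"
    by (simp add: blinfun.diff_right blinfun.scaleR_right cinner.diff_left cinner.diff_right
        cinner.scaleR_left cinner.scaleR_right self_adjointD[OF sa, of y x] y_def[symmetric]
        Re_cinner_self power2_eq_square algebra_simps)
  finally have "c * (norm y)\<^sup>2 \<le> c * (c * Re (cinner (A x) x))"
    using 1 by (simp add: power2_eq_square algebra_simps)
  then show ?thesis
    using c(2) unfolding y_def by simp
qed

lemma positive_op_eq_0:
  assumes A: "positive_op A" and "Re (cinner (blinfun_apply A x) x) = 0"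
  shows "blinfun_apply A x = 0"
proof -
  \<comment> \<open>Adding 1 keeps the constant positive when \<open>A\<close> is zero.\<close>
  have "norm A \<le> norm A + 1" "norm A + 1 > 0"
    by (auto intro: add_nonneg_pos)
  from positive_op_norm_squared_le[OF A this, of x] assms(2) show ?thesis
    by simp
qed

text \<open>If \<open>S = 1 - A\<close>, the limit \<open>R\<close> of these iterates solves \<open>R = (S + R\<^sup>2) / 2\<close>, that is
  \<open>(1 - R)\<^sup>2 = A\<close>. The scalar iteration \<open>sqrt_iter_bound\<close> dominates the increments in norm.\<close>

primrec sqrt_iter :: "('a::real_normed_vector \<Rightarrow>\<^sub>L 'a) \<Rightarrow> nat \<Rightarrow> 'a \<Rightarrow>\<^sub>L 'a" where
  "sqrt_iter S 0 = 0"
| "sqrt_iter S (Suc n) = (1/2) *\<^sub>R (S + (sqrt_iter S n o\<^sub>L sqrt_iter S n))"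

primrec sqrt_iter_bound :: "nat \<Rightarrow> real" where
  "sqrt_iter_bound 0 = 0"
| "sqrt_iter_bound (Suc n) = (1 + (sqrt_iter_bound n)\<^sup>2) / 2"

lemma sqrt_iter_bound_range: "0 \<le> sqrt_iter_bound n \<and> sqrt_iter_bound n \<le> 1"
  by (induction n) (auto simp: power_le_one)

lemma sqrt_iter_bound_mono: "sqrt_iter_bound n \<le> sqrt_iter_bound (Suc n)"
proof (induction n)
  case (Suc n)
  then have "(sqrt_iter_bound n)\<^sup>2 \<le> (sqrt_iter_bound (Suc n))\<^sup>2"
    using sqrt_iter_bound_range by (intro power_mono) blast+
  then show ?case
    by (simp del: sqrt_iter_bound.simps(2) add: sqrt_iter_bound.simps(2)[of "Suc n"])
      (simp add: field_simps)
qed simp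

text \<open>Monotonicity and boundedness replace a contraction argument: the map taking t to (1 +
  t^2)/2 has derivative 1 at its fixed point 1, so no geometric rate is available.\<close>

lemma sqrt_iter_bound_Cauchy: "Cauchy sqrt_iter_bound"
proof -
  have "incseq sqrt_iter_bound"
    by (rule incseq_SucI) (rule sqrt_iter_bound_mono)
  then obtain L where "sqrt_iter_bound \<longlonglongrightarrow> L"
    using sqrt_iter_bound_range incseq_convergent[of sqrt_iter_bound 1] by blast
  then show ?thesis
    by (rule LIMSEQ_imp_Cauchy)
qed

lemma norm_sqrt_iter_le: "norm S \<le> 1 \<Longrightarrow> norm (sqrt_iter S n) \<le> sqrt_iter_bound n"
proof (induction n)
  case (Suc n)
  have "norm (sqrt_iter S n o\<^sub>L sqrt_iter S n) \<le> norm (sqrt_iter S n) * norm (sqrt_iter S n)"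
    by (rule norm_blinfun_compose)
  also have "\<dots> \<le> (sqrt_iter_bound n)\<^sup>2"
    using Suc sqrt_iter_bound_range[of n] by (simp add: power2_eq_square mult_mono)
  finally show ?case
    using norm_triangle_ineq[of S "sqrt_iter S n o\<^sub>L sqrt_iter S n"] Suc.prems by simp
qed simp

lemma norm_sqrt_iter_increment:
  assumes S: "norm S \<le> 1"
  shows "norm (sqrt_iter S (Suc n) - sqrt_iter S n) \<le> sqrt_iter_bound (Suc n) - sqrt_iter_bound n"
proof (induction n)
  case (Suc n)
  define X Y where "X = sqrt_iter S (Suc n)" and "Y = sqrt_iter S n"
  define x y where "x = sqrt_iter_bound (Suc n)" and "y = sqrt_iter_bound n"
  interpret comp: bounded_bilinear "(o\<^sub>L) :: ('a \<Rightarrow>\<^sub>L 'a) \<Rightarrow> ('a \<Rightarrow>\<^sub>L 'a) \<Rightarrow> 'a \<Rightarrow>\<^sub>L 'a"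
    by (rule bounded_bilinear_blinfun_compose)
  have XY: "norm X \<le> x" "norm Y \<le> y" "norm (X - Y) \<le> x - y"
    using norm_sqrt_iter_le[OF S] Suc
      by (simp_all add: X_def Y_def x_def y_def del: sqrt_iter.simps sqrt_iter_bound.simps)
  have xy: "0 \<le> y" "y \<le> x"
    using sqrt_iter_bound_range sqrt_iter_bound_mono
    by (simp_all add: x_def y_def del: sqrt_iter_bound.simps)
  have "sqrt_iter S (Suc (Suc n)) - sqrt_iter S (Suc n) = (1/2) *\<^sub>R ((X o\<^sub>L X) - (Y o\<^sub>L Y))"
    by (simp add: X_def Y_def scaleR_right_diff_distrib scaleR_right_distrib)
  \<comment> \<open>This factorization does not require \<open>X\<close> and \<open>Y\<close> to
    commute, and its norm estimate reproduces the scalar identity x^2 - y^2 = x (x - y) + (x - y)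
    y.\<close>
  also have "(X o\<^sub>L X) - (Y o\<^sub>L Y) = (X o\<^sub>L (X - Y)) + ((X - Y) o\<^sub>L Y)"
    by (simp add: comp.diff_left comp.diff_right)
  finally have "norm (sqrt_iter S (Suc (Suc n)) - sqrt_iter S (Suc n)) =
      norm ((X o\<^sub>L (X - Y)) + ((X - Y) o\<^sub>L Y)) / 2"
    by simp
  also have "\<dots> \<le> (norm X * norm (X - Y) + norm (X - Y) * norm Y) / 2"
    by (intro divide_right_mono norm_triangle_mono norm_blinfun_compose) simp
  also have "\<dots> \<le> (x * (x - y) + (x - y) * y) / 2"
    using XY xy by (intro divide_right_mono add_mono mult_mono) auto
  also have "\<dots> = sqrt_iter_bound (Suc (Suc n)) - sqrt_iter_bound (Suc n)"
    unfolding x_def y_def sqrt_iter_bound.simps(2)[of "Suc n"]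
    by (simp add: power2_eq_square field_simps)
  finally show ?case .
qed (use S in simp)

lemma norm_sqrt_iter_diff:
  assumes S: "norm S \<le> 1" and "n \<le> m"
  shows "norm (sqrt_iter S m - sqrt_iter S n) \<le> sqrt_iter_bound m - sqrt_iter_bound n"
  using \<open>n \<le> m\<close>
proof (induction m rule: dec_induct)
  case (step m)
  then show ?case
    using norm_sqrt_iter_increment[OF S, of m]
      norm_triangle_ineq[of "sqrt_iter S (Suc m) - sqrt_iter S m" "sqrt_iter S m - sqrt_iter S n"]
    by (simp del: sqrt_iter.simps sqrt_iter_bound.simps)
qed simp

lemma sqrt_iter_Cauchy:
  fixes S :: "'a::real_normed_vector \<Rightarrow>\<^sub>L 'a"
  assumes S: "norm S \<le> 1"
  shows "Cauchy (sqrt_iter S)"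
proof (rule metric_CauchyI)
  fix e :: real assume "e > 0"
  then obtain N where N: "\<And>m n. m \<ge> N \<Longrightarrow> n \<ge> N \<Longrightarrow> dist (sqrt_iter_bound m) (sqrt_iter_bound n) < e"
    using metric_CauchyD[OF sqrt_iter_bound_Cauchy] by blast
  have *: "dist (sqrt_iter S m) (sqrt_iter S n) < e" if "m \<ge> N" "n \<ge> N" "n \<le> m" for m n
    using norm_sqrt_iter_diff[OF S that(3)] N[OF that(1,2)] by (simp add: dist_norm)
  then show "\<exists>M. \<forall>m\<ge>M. \<forall>n\<ge>M. dist (sqrt_iter S m) (sqrt_iter S n) < e"
    by (intro exI[of _ N]) (metis dist_commute nle_le)
qed

lemma sqrt_iter_commute:
  assumes "\<And>x. blinfun_apply S (blinfun_apply B x) = blinfun_apply B (blinfun_apply S x)"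
  shows "blinfun_apply (sqrt_iter S n) (blinfun_apply B x) = blinfun_apply B (blinfun_apply (sqrt_iter S n) x)"
  by (induction n arbitrary: x)
    (simp_all add: assms blinfun.scaleR_left blinfun.add_left blinfun.scaleR_right blinfun.add_right)

lemma self_adjoint_sqrt_iter: "self_adjoint S \<Longrightarrow> self_adjoint (sqrt_iter S n)"
proof (induction n)
  case 0
  then show ?case
    by (simp add: self_adjoint_iff bounded_ops_def cinner.zero_left cinner.zero_right
        complex_vector.scale_zero_right)
next
  case (Suc n)
  then show ?case
    by (simp add: self_adjoint_scaleR self_adjoint_add self_adjoint_compose_commute)
qed

text \<open>The commutation clause is carried along because it later yields uniqueness of the root
  and lets operators that commute with \<open>T\<close> commute with its modulus. It holds for each
  iterate and survives the limit.\<close>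

lemma positive_contraction_sqrt:
  fixes A :: "'a::complex_hilbert_space \<Rightarrow>\<^sub>L 'a"
  assumes A: "positive_op A" and nA: "norm A \<le> 1"
  shows "\<exists>P. positive_op P \<and> P o\<^sub>L P = A \<and>
    (\<forall>B::'a \<Rightarrow>\<^sub>L 'a. (\<forall>x. A (B x) = B (A x)) \<longrightarrow> (\<forall>x. P (B x) = B (P x)))"
proof -
  interpret comp: bounded_bilinear "(o\<^sub>L) :: ('a \<Rightarrow>\<^sub>L 'a) \<Rightarrow> ('a \<Rightarrow>\<^sub>L 'a) \<Rightarrow> 'a \<Rightarrow>\<^sub>L 'a"
    by (rule bounded_bilinear_blinfun_compose)
  define S where "S = id_blinfun - A"
  have saS: "self_adjoint S"
    unfolding S_def by (intro self_adjoint_diff self_adjoint_id positive_opD(1)[OF A])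
  have nS: "norm S \<le> 1"
  proof (rule norm_blinfun_bound)
    fix x
    have "(norm (S x))\<^sup>2 = (norm x)\<^sup>2 + (norm (A x))\<^sup>2 - 2 * Re (cinner (A x) x)"
      unfolding S_def by (simp add: blinfun.diff_left norm_diff_squared Re_cinner_commute[of x])
    also have "\<dots> \<le> (norm x)\<^sup>2"
      using positive_op_norm_squared_le[OF A nA, of x] positive_opD(2)[OF A, of x] by simp
    finally show "norm (S x) \<le> 1 * norm x"
      using power2_le_imp_le[of "norm (S x)" "norm x"] by simp
  qed simp
  obtain R where R: "sqrt_iter S \<longlonglongrightarrow> R"
    using sqrt_iter_Cauchy[OF nS] Cauchy_convergent convergent_def by blast
  have saR: "self_adjoint R"
    by (rule self_adjoint_limit[OF self_adjoint_sqrt_iter[OF saS] R])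
  have nR: "norm R \<le> 1"
  proof (rule LIMSEQ_le_const2)
    show "(\<lambda>n. norm (sqrt_iter S n)) \<longlonglongrightarrow> norm R"
      by (rule tendsto_norm[OF R])
    show "\<exists>N. \<forall>n\<ge>N. norm (sqrt_iter S n) \<le> 1"
    proof (intro exI allI impI)
      show "norm (sqrt_iter S n) \<le> 1" for n
        using norm_sqrt_iter_le[OF nS, of n] sqrt_iter_bound_range[of n] by linarith
    qed
  qed
  have "(\<lambda>n. (1/2) *\<^sub>R (S + (sqrt_iter S n o\<^sub>L sqrt_iter S n))) \<longlonglongrightarrow> (1/2) *\<^sub>R (S + (R o\<^sub>L R))"
    by (intro tendsto_scaleR tendsto_add comp.tendsto tendsto_const R)
  moreover have "(\<lambda>n. (1/2) *\<^sub>R (S + (sqrt_iter S n o\<^sub>L sqrt_iter S n))) \<longlonglongrightarrow> R"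
    using LIMSEQ_Suc[OF R] by simp
  ultimately have "R = (1/2) *\<^sub>R (S + (R o\<^sub>L R))"
    using LIMSEQ_unique by blast
  from arg_cong[OF this, of "\<lambda>F. 2 *\<^sub>R F"] have R_eq: "2 *\<^sub>R R = S + (R o\<^sub>L R)"
    by simp
  have "positive_op (id_blinfun - R)"
    unfolding positive_op_def
  proof (intro conjI allI)
    show "self_adjoint (id_blinfun - R)"
      by (intro self_adjoint_diff self_adjoint_id saR)
    fix x
    have "Re (cinner (R x) x) \<le> norm (R x) * norm x"
      using norm_cinner_le complex_Re_le_cmod order_trans by blast
    also have "\<dots> \<le> (1 * norm x) * norm x"
      using nR by (intro mult_right_mono order_trans[OF norm_blinfun]) auto
    finally show "0 \<le> Re (cinner ((id_blinfun - R) x) x)"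
      by (simp add: blinfun.diff_left cinner.diff_left Re_cinner_self power2_eq_square)
  qed
  moreover have "(id_blinfun - R) o\<^sub>L (id_blinfun - R) = A"
  proof (rule blinfun_eqI)
    fix x
    have "2 *\<^sub>R R x = x - A x + R (R x)"
      using arg_cong[OF R_eq, of "\<lambda>F. blinfun_apply F x"]
      by (simp add: blinfun.scaleR_left blinfun.add_left blinfun.diff_left S_def)
    then have "x - 2 *\<^sub>R R x + R (R x) = A x"
      by (simp only:) simp
    then show "((id_blinfun - R) o\<^sub>L (id_blinfun - R)) x = A x"
      by (simp add: blinfun.diff_left blinfun.diff_right scaleR_2 algebra_simps)
  qed
  moreover have "(id_blinfun - R) (B x) = B ((id_blinfun - R) x)"
    if "\<forall>x. A (B x) = B (A x)" for B :: "'a \<Rightarrow>\<^sub>L 'a" and x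
  proof -
    have "S (B x) = B (S x)" for x
      using that by (simp add: S_def blinfun.diff_left blinfun.diff_right)
    then have "sqrt_iter S n (B x) = B (sqrt_iter S n x)" for n
      by (rule sqrt_iter_commute)
    moreover have "(\<lambda>n. sqrt_iter S n (B x)) \<longlonglongrightarrow> R (B x)" "(\<lambda>n. B (sqrt_iter S n x)) \<longlonglongrightarrow> B (R x)"
      by (intro blinfun.tendsto tendsto_const R)+
    ultimately have "R (B x) = B (R x)"
      using LIMSEQ_unique by simp
    then show ?thesis
      by (simp add: blinfun.diff_left blinfun.diff_right)
  qed
  ultimately show ?thesis
    by (intro exI[of _ "id_blinfun - R"]) simp
qed

section \<open>Roots of general positive operators and the modulus\<close>

lemma positive_op_scaleR: "positive_op A \<Longrightarrow> 0 \<le> r \<Longrightarrow> positive_op (r *\<^sub>R A)"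
  by (simp add: positive_op_def self_adjoint_scaleR blinfun.scaleR_left cinner.scaleR_left)

lemma positive_sqrt_exists:
  fixes A :: "'a::complex_hilbert_space \<Rightarrow>\<^sub>L 'a"
  assumes A: "positive_op A"
  shows "\<exists>P. positive_op P \<and> P o\<^sub>L P = A \<and>
    (\<forall>B::'a \<Rightarrow>\<^sub>L 'a. (\<forall>x. A (B x) = B (A x)) \<longrightarrow> (\<forall>x. P (B x) = B (P x)))"
proof -
  define c where "c = norm A + 1"
  have c: "c > 0"
    by (simp add: c_def add_nonneg_pos)
  have "positive_op ((1/c) *\<^sub>R A)" "norm ((1/c) *\<^sub>R A) \<le> 1"
    using A c by (auto simp: positive_op_scaleR c_def)
  from positive_contraction_sqrt[OF this] obtain P where P: "positive_op P" "P o\<^sub>L P = (1/c) *\<^sub>R A"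
    "\<And>(B::'a \<Rightarrow>\<^sub>L 'a) x. (\<forall>x. ((1/c) *\<^sub>R A) (B x) = B (((1/c) *\<^sub>R A) x)) \<Longrightarrow> P (B x) = B (P x)"
    by blast
  show ?thesis
  proof (intro exI[of _ "sqrt c *\<^sub>R P"] conjI allI impI)
    show "positive_op (sqrt c *\<^sub>R P)"
      using c by (intro positive_op_scaleR P(1)) simp
    show "(sqrt c *\<^sub>R P) o\<^sub>L (sqrt c *\<^sub>R P) = A"
    proof (rule blinfun_eqI)
      fix x
      have "P (P x) = (1/c) *\<^sub>R A x"
        using arg_cong[OF P(2), of "\<lambda>F. blinfun_apply F x"] by (simp add: blinfun.scaleR_left)
      then show "((sqrt c *\<^sub>R P) o\<^sub>L (sqrt c *\<^sub>R P)) x = A x"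
        using c by (simp add: blinfun.scaleR_left blinfun.scaleR_right)
    qed
    fix B :: "'a \<Rightarrow>\<^sub>L 'a" and x assume "\<forall>x. A (B x) = B (A x)"
    then have "P (B x) = B (P x)"
      by (intro P(3)) (simp add: blinfun.scaleR_left blinfun.scaleR_right)
    then show "(sqrt c *\<^sub>R P) (B x) = B ((sqrt c *\<^sub>R P) x)"
      by (simp add: blinfun.scaleR_left blinfun.scaleR_right)
  qed
qed

text \<open>With D = P - Q, commutation gives (P + Q) D = P^2 - Q^2 = 0. Both forms then vanish at
  \<open>D x\<close>, so \<open>P\<close> and \<open>Q\<close> kill it, D^2 = 0, and
  self-adjointness gives D = 0. Commutation is available for any root \<open>Q\<close> of
  \<open>A\<close>: it commutes with \<open>A\<close>, hence with the root constructed from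
  \<open>A\<close>.\<close>

lemma positive_sqrt_unique:
  assumes P: "positive_op P" and Q: "positive_op Q"
    and eq: "\<And>x. blinfun_apply P (blinfun_apply P x) = blinfun_apply Q (blinfun_apply Q x)"
    and comm: "\<And>x. blinfun_apply P (blinfun_apply Q x) = blinfun_apply Q (blinfun_apply P x)"
  shows "P = Q"
proof (rule blinfun_eqI)
  fix x
  define D where "D = P - Q"
  have saD: "self_adjoint D"
    unfolding D_def by (intro self_adjoint_diff positive_opD(1) P Q)
  define y where "y = D x"
  have "P y + Q y = 0"
    unfolding y_def D_def by (simp add: blinfun.diff_left blinfun.diff_right eq comm)
  then have "Re (cinner (P y) y) + Re (cinner (Q y) y) = 0"
    by (metis cinner.add_left cinner.zero_left plus_complex.sel(1) zero_complex.sel(1))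
  then have "Re (cinner (P y) y) = 0" "Re (cinner (Q y) y) = 0"
    using positive_opD(2)[OF P, of y] positive_opD(2)[OF Q, of y] by simp_all
  then have "D y = 0"
    using positive_op_eq_0[OF P, of y] positive_op_eq_0[OF Q, of y]
    by (simp add: D_def blinfun.diff_left)
  then have "D x = 0"
    using cinner_square[OF saD, of x] by (simp add: y_def cinner.zero_left)
  then show "P x = Q x"
    by (simp add: D_def blinfun.diff_left)
qed

lemma op_sqrt:
  fixes A :: "'a::complex_hilbert_space \<Rightarrow>\<^sub>L 'a"
  assumes A: "positive_op A"
  shows positive_op_sqrt: "positive_op (op_sqrt A)"
    and op_sqrt_square: "op_sqrt A o\<^sub>L op_sqrt A = A"
    and op_sqrt_commute: "\<And>(B::'a \<Rightarrow>\<^sub>L 'a) x. (\<And>x. A (B x) = B (A x)) \<Longrightarrow>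
      op_sqrt A (B x) = B (op_sqrt A x)"
proof -
  obtain P where P: "positive_op P" "P o\<^sub>L P = A"
    "\<forall>B::'a \<Rightarrow>\<^sub>L 'a. (\<forall>x. A (B x) = B (A x)) \<longrightarrow> (\<forall>x. P (B x) = B (P x))"
    using positive_sqrt_exists[OF A] by auto
  have "op_sqrt A = P"
    unfolding op_sqrt_def
  proof (rule the_equality)
    fix Q assume Q: "positive_op Q \<and> Q o\<^sub>L Q = A"
    then have AQ: "A x = Q (Q x)" for x
      by auto
    have AP: "A x = P (P x)" for x
      unfolding P(2)[symmetric] by simp
    have "P (Q x) = Q (P x)" for x
      using P(3) by (simp add: AQ)
    then show "Q = P"
      using positive_sqrt_unique[of Q P] P(1) Q by (simp add: AP[symmetric] AQ[symmetric])
  qed (use P in simp)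
  then show "positive_op (op_sqrt A)" "op_sqrt A o\<^sub>L op_sqrt A = A"
    using P(1,2) by simp_all
  show "op_sqrt A (B x) = B (op_sqrt A x)" if "\<And>x. A (B x) = B (A x)" for B :: "'a \<Rightarrow>\<^sub>L 'a" and x
    unfolding \<open>op_sqrt A = P\<close> using P(3) that by simp
qed

lemma op_abs:
  fixes T :: "'a::complex_hilbert_space \<Rightarrow>\<^sub>L 'a"
  assumes T: "self_adjoint T"
  shows positive_op_abs: "positive_op (op_abs T)"
    and op_abs_op_abs: "op_abs T (op_abs T x) = T (T x)"
    and op_abs_commute: "\<And>(B::'a \<Rightarrow>\<^sub>L 'a) x. (\<And>x. T (B x) = B (T x)) \<Longrightarrow>
      op_abs T (B x) = B (op_abs T x)"
    and norm_op_abs: "norm (op_abs T x) = norm (T x)"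
proof -
  have A: "positive_op (T o\<^sub>L T)"
    by (rule positive_op_square[OF T])
  have abs: "op_abs T = op_sqrt (T o\<^sub>L T)"
    using T by (simp add: op_abs_def self_adjoint_def)
  show pos: "positive_op (op_abs T)"
    unfolding abs by (rule positive_op_sqrt[OF A])
  have sq: "op_abs T (op_abs T x) = T (T x)" for x
    using arg_cong[OF op_sqrt_square[OF A], of "\<lambda>F. blinfun_apply F x"] by (simp add: abs)
  show "op_abs T (op_abs T x) = T (T x)"
    by (rule sq)
  show "op_abs T (B x) = B (op_abs T x)" if "\<And>x. T (B x) = B (T x)" for B :: "'a \<Rightarrow>\<^sub>L 'a" and x
    unfolding abs by (rule op_sqrt_commute[OF A]) (simp add: that)
  have "complex_of_real ((norm (op_abs T x))\<^sup>2) = complex_of_real ((norm (T x))\<^sup>2)"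
    using cinner_square[OF positive_opD(1)[OF pos], of x] cinner_square[OF T, of x] sq[of x] by simp
  then show "norm (op_abs T x) = norm (T x)"
    by (simp only: of_real_eq_iff) simp
qed

subsection \<open>The modulus as a compact perturbation of a scalar\<close>

lemma unit_vector_bound:
  assumes V: "subspace V" and x: "x \<in> V"
    and unit: "\<And>u. u \<in> V \<Longrightarrow> norm u = 1 \<Longrightarrow> norm (blinfun_apply B u) \<le> c"
  shows "norm (blinfun_apply B x) \<le> c * norm x"
proof (cases "x = 0")
  case False
  have "norm (B ((1 / norm x) *\<^sub>R x)) \<le> c"
    using False V x by (intro unit subspace_scale) simp_all
  then show ?thesis
    using False by (simp add: blinfun.scaleR_right field_simps)
qed (simp add: blinfun.zero_right)

text \<open>Polarization gives control of the norm from the quadratic form, after enlarging \<open>F\<close> by its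
  image so that \<open>B\<close> maps the orthogonal complement of the larger set into that of \<open>F\<close>.\<close>

lemma small_off_finite_quadratic_form:
  assumes B: "self_adjoint B"
    and form: "\<And>\<epsilon>. \<epsilon> > 0 \<Longrightarrow> \<exists>F. finite F \<and>
      (\<forall>x\<in>orth_compl F. \<bar>Re (cinner (blinfun_apply B x) x)\<bar> \<le> \<epsilon> * (norm x)\<^sup>2)"
  shows "small_off_finite B"
  unfolding small_off_finite_def
proof (intro allI impI)
  fix \<epsilon> :: real assume "\<epsilon> > 0"
  from form[OF this] obtain F where F: "finite F"
    "\<And>x. x \<in> orth_compl F \<Longrightarrow> \<bar>Re (cinner (B x) x)\<bar> \<le> \<epsilon> * (norm x)\<^sup>2"
    by auto
  have V: "subspace (orth_compl F)"
    by (rule complex_subspace_imp_subspace[OF subspace_orth_compl])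
  have "norm (B u) \<le> \<epsilon>" if u: "u \<in> orth_compl (F \<union> B ` F)" "norm u = 1" for u
  proof (cases "B u = 0")
    case False
    have uF: "u \<in> orth_compl F"
      using u(1) by (simp add: orth_compl_Un)
    \<comment> \<open>Pairing \<open>B u\<close> with the unit vector in its own direction recovers
      \<open>norm (B u)\<close>, which polarization then expresses through values of the form at
      \<open>u + w\<close> and \<open>u - w\<close>.\<close>
    define w where "w = (1 / norm (B u)) *\<^sub>R B u"
    have w1: "norm w = 1"
      using False by (simp add: w_def)
    have "B u \<in> orth_compl F"
      using u(1) by (auto simp: orth_compl_def self_adjointD[OF B])
    then have wF: "w \<in> orth_compl F"
      unfolding w_def by (intro subspace_scale V)
    have Re_w: "Re (cinner (B u) w) = norm (B u)"
      using False by (simp add: w_def cinner.scaleR_right cinner_self power2_eq_square)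
    have "cinner (B w) u = cnj (cinner (B u) w)"
      using self_adjointD[OF B, of w u] cinner_commute[of w "B u"] by simp
    then have Re_w': "Re (cinner (B w) u) = norm (B u)"
      using Re_w by simp
    have "4 * norm (B u) = Re (cinner (B (u + w)) (u + w)) - Re (cinner (B (u - w)) (u - w))"
      using Re_w Re_w' by (simp add: blinfun.add_right blinfun.diff_right cinner.add_left
          cinner.add_right cinner.diff_left cinner.diff_right)
    also have "\<dots> \<le> \<epsilon> * (norm (u + w))\<^sup>2 + \<epsilon> * (norm (u - w))\<^sup>2"
      using F(2)[OF subspace_add[OF V uF wF]] F(2)[OF subspace_diff[OF V uF wF]] by linarith
    also have "\<dots> = 4 * \<epsilon>"
      by (simp add: norm_add_squared norm_diff_squared u(2) w1 algebra_simps)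
    finally show ?thesis
      by simp
  qed (use \<open>\<epsilon> > 0\<close> in simp)
  then have "norm (B x) \<le> \<epsilon> * norm x" if "x \<in> orth_compl (F \<union> B ` F)" for x
    by (rule unit_vector_bound[OF complex_subspace_imp_subspace[OF subspace_orth_compl] that])
  then show "\<exists>F. finite F \<and> (\<forall>x\<in>orth_compl F. norm (B x) \<le> \<epsilon> * norm x)"
    using F(1) by (intro exI[of _ "F \<union> B ` F"]) simp
qed

text \<open>The form of T^2 - \<alpha>^2 at a unit vector is the difference of squares of
  \<open>norm (T x)\<close> and \<alpha>, so the estimate for \<open>norm (T x)\<close> controls it
  up to a bounded factor.\<close>

lemma closure_AN_square_small_off_finite:
  fixes T :: "'a::complex_hilbert_space \<Rightarrow>\<^sub>L 'a"
  assumes T: "self_adjoint T" and \<alpha>: "\<alpha> \<ge> 0"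
    and ess: "\<And>\<epsilon>. \<epsilon> > 0 \<Longrightarrow>
      \<exists>F. finite F \<and> (\<forall>x\<in>orth_compl F. norm x = 1 \<longrightarrow> \<bar>norm (T x) - \<alpha>\<bar> < \<epsilon>)"
  shows "small_off_finite ((T o\<^sub>L T) - \<alpha>\<^sup>2 *\<^sub>R id_blinfun)"
proof (rule small_off_finite_quadratic_form)
  show "self_adjoint ((T o\<^sub>L T) - \<alpha>\<^sup>2 *\<^sub>R id_blinfun)"
    by (intro self_adjoint_diff self_adjoint_scaleR self_adjoint_id self_adjoint_compose_commute T refl)
  fix \<epsilon> :: real assume \<epsilon>: "\<epsilon> > 0"
  define c where "c = norm T + \<alpha> + 1"
  have c: "c > 0"
    using \<alpha> by (simp add: c_def add_nonneg_pos)
  with \<epsilon> have "\<epsilon> / c > 0"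
    by simp
  from ess[OF this] obtain F where F: "finite F"
    "\<And>x. x \<in> orth_compl F \<Longrightarrow> norm x = 1 \<Longrightarrow> \<bar>norm (T x) - \<alpha>\<bar> < \<epsilon> / c"
    by auto
  have form: "Re (cinner (((T o\<^sub>L T) - \<alpha>\<^sup>2 *\<^sub>R id_blinfun) x) x) = (norm (T x))\<^sup>2 - \<alpha>\<^sup>2 * (norm x)\<^sup>2" for x
    by (simp add: blinfun.diff_left blinfun.scaleR_left cinner.diff_left cinner.scaleR_left
        cinner_square[OF T] cinner_self)
  have unit: "\<bar>(norm (T u))\<^sup>2 - \<alpha>\<^sup>2\<bar> \<le> \<epsilon>" if u: "u \<in> orth_compl F" "norm u = 1" for u
  proof -
    have "\<bar>(norm (T u))\<^sup>2 - \<alpha>\<^sup>2\<bar> = \<bar>norm (T u) - \<alpha>\<bar> * (norm (T u) + \<alpha>)"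
      using \<alpha> by (simp add: power2_eq_square square_diff_square_factored abs_mult)
    also have "\<dots> \<le> \<epsilon> / c * c"
      using F(2)[OF u] norm_blinfun[of T u] u(2) \<alpha> c \<epsilon> by (intro mult_mono) (auto simp: c_def)
    also have "\<dots> = \<epsilon>"
      using c by simp
    finally show ?thesis .
  qed
  have "\<bar>(norm (T x))\<^sup>2 - \<alpha>\<^sup>2 * (norm x)\<^sup>2\<bar> \<le> \<epsilon> * (norm x)\<^sup>2" if x: "x \<in> orth_compl F" for x
  proof (cases "x = 0")
    case False
    have "(1 / norm x) *\<^sub>R x \<in> orth_compl F"
      using x by (intro subspace_scale complex_subspace_imp_subspace[OF subspace_orth_compl])
    then have "\<bar>(norm (T ((1 / norm x) *\<^sub>R x)))\<^sup>2 - \<alpha>\<^sup>2\<bar> \<le> \<epsilon>"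
      using False by (intro unit) simp_all
    also have "(norm (T ((1 / norm x) *\<^sub>R x)))\<^sup>2 - \<alpha>\<^sup>2 =
        ((norm (T x))\<^sup>2 - \<alpha>\<^sup>2 * (norm x)\<^sup>2) / (norm x)\<^sup>2"
      using False by (simp add: blinfun.scaleR_right power_divide diff_divide_distrib)
    finally show ?thesis
      using False by (simp add: field_simps abs_divide)
  qed (simp add: blinfun.zero_right)
  then show "\<exists>F. finite F \<and> (\<forall>x\<in>orth_compl F.
      \<bar>Re (cinner (((T o\<^sub>L T) - \<alpha>\<^sup>2 *\<^sub>R id_blinfun) x) x)\<bar> \<le> \<epsilon> * (norm x)\<^sup>2)"
    unfolding form using F(1) by blast
qed

lemma closure_AN_op_abs:
  fixes T :: "'a::complex_hilbert_space \<Rightarrow>\<^sub>L 'a"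
  assumes inf: "\<not> (\<exists>B::'a set. finite B \<and> complex_vector.span B = UNIV)"
    and T: "T \<in> closure AN_ops" "self_adjoint T"
  obtains \<alpha> where "\<alpha> \<ge> 0" "small_off_finite (op_abs T - \<alpha> *\<^sub>R id_blinfun)"
proof -
  obtain \<alpha> where \<alpha>: "\<alpha> \<ge> 0" and ess: "\<And>\<epsilon>. \<epsilon> > 0 \<Longrightarrow>
      \<exists>F. finite F \<and> (\<forall>x\<in>orth_compl F. norm x = 1 \<longrightarrow> \<bar>norm (T x) - \<alpha>\<bar> < \<epsilon>)"
    using closure_AN_essential_norm[OF inf T(1)] by blast
  define P where "P = op_abs T"
  note P = positive_op_abs[OF T(2), folded P_def]
  have "small_off_finite (P - \<alpha> *\<^sub>R id_blinfun)"
  proof (cases "\<alpha> = 0")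
    case True
    have "small_off_finite P"
      unfolding small_off_finite_def
    proof (intro allI impI)
      fix \<epsilon> :: real assume "\<epsilon> > 0"
      from ess[OF this] obtain F where F: "finite F"
        "\<And>x. x \<in> orth_compl F \<Longrightarrow> norm x = 1 \<Longrightarrow> norm (P x) < \<epsilon>"
        using True by (auto simp: P_def norm_op_abs[OF T(2)])
      then have "norm (P x) \<le> \<epsilon> * norm x" if "x \<in> orth_compl F" for x
        by (intro unit_vector_bound[OF complex_subspace_imp_subspace[OF subspace_orth_compl] that])
          (simp add: less_imp_le)
      with F(1) show "\<exists>F. finite F \<and> (\<forall>x\<in>orth_compl F. norm (P x) \<le> \<epsilon> * norm x)"
        by blast
    qed
    then show ?thesis
      using True by simp
  next
    case False
    with \<alpha> have \<alpha>0: "\<alpha> > 0"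
      by simp
    show ?thesis
    proof (rule small_off_finite_dominated[OF closure_AN_square_small_off_finite[OF T(2) \<alpha> ess]])
      fix x
      define y where "y = (P - \<alpha> *\<^sub>R id_blinfun) x"
      have "((T o\<^sub>L T) - \<alpha>\<^sup>2 *\<^sub>R id_blinfun) x = P y + \<alpha> *\<^sub>R y"
        by (simp add: y_def P_def blinfun.diff_left blinfun.scaleR_left blinfun.diff_right
            blinfun.scaleR_right op_abs_op_abs[OF T(2)] power2_eq_square algebra_simps)
      \<comment> \<open>Positivity of \<open>P\<close> makes the cross term nonnegative, so P +
        \<alpha> is bounded below by \<alpha>. Dividing by \<alpha> afterwards is what forces the
        case distinction.\<close>
      moreover have "(\<alpha> * norm y)\<^sup>2 \<le> (norm (P y + \<alpha> *\<^sub>R y))\<^sup>2"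
        using positive_opD(2)[OF P, of y] \<alpha>0
        by (simp add: norm_add_squared cinner.scaleR_right power_mult_distrib)
      then have "\<alpha> * norm y \<le> norm (P y + \<alpha> *\<^sub>R y)"
        using power2_le_imp_le norm_ge_zero by blast
      ultimately show "norm ((P - \<alpha> *\<^sub>R id_blinfun) x) \<le>
          (1 / \<alpha>) * norm (((T o\<^sub>L T) - \<alpha>\<^sup>2 *\<^sub>R id_blinfun) x)"
        using \<alpha>0 by (simp add: y_def[symmetric] field_simps)
    qed
  qed
  with \<alpha> show thesis
    using that unfolding P_def by blast
qed

subsection \<open>Polar decomposition and negative part\<close>

text \<open>A vector orthogonal to the range of a self-adjoint operator lies in its kernel, so sums
  of kernel and range vectors are dense. Phrased with a closed set \<open>C\<close>, this reduces
  any closed condition on \<open>x\<close> to vectors \<open>n + Q y\<close>.\<close>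

lemma null_range_dense:
  fixes Q :: "'a::complex_hilbert_space \<Rightarrow>\<^sub>L 'a"
  assumes Q: "self_adjoint Q" and C: "closed C"
    and sub: "\<And>n y. Q n = 0 \<Longrightarrow> n + Q y \<in> C"
  shows "x \<in> C"
proof -
  define V where "V = {n + Q y | n y. Q n = 0}"
  note lin = bounded_opsD[OF self_adjoint_bounded_ops[OF Q]]
  have V: "complex_vector.subspace V"
    unfolding complex_vector.subspace_def
  proof (intro conjI ballI allI)
    show "0 \<in> V"
      unfolding V_def by (intro CollectI exI[of _ 0]) (simp add: blinfun.zero_right)
  next
    fix a b assume "a \<in> V" "b \<in> V"
    then obtain n y m z where *: "a = n + Q y" "Q n = 0" "b = m + Q z" "Q m = 0"
      unfolding V_def by blast
    have "a + b = (n + m) + Q (y + z)" "Q (n + m) = 0"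
      using * by (simp_all add: blinfun.add_right)
    then show "a + b \<in> V"
      unfolding V_def by blast
  next
    fix c a assume "a \<in> V"
    then obtain n y where *: "a = n + Q y" "Q n = 0"
      unfolding V_def by blast
    have "c *\<^sub>C a = c *\<^sub>C n + Q (c *\<^sub>C y)" "Q (c *\<^sub>C n) = 0"
      using * by (simp_all add: lin scaleC_add_right complex_vector.scale_zero_right)
    then show "c *\<^sub>C a \<in> V"
      unfolding V_def by blast
  qed
  have "x \<in> closure V"
  proof (rule closed_complex_subspace_eq_UNIV[OF closed_closure closure_complex_subspace[OF V]])
    fix u assume u: "\<And>w. w \<in> closure V \<Longrightarrow> cinner u w = 0"
    have mem: "n + Q y \<in> closure V" if "Q n = 0" for n y
      using that closure_subset[of V] unfolding V_def by blast
    have "cinner u (Q (Q u)) = 0"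
      using u[OF mem[of 0 "Q u"]] by (simp add: blinfun.zero_right)
    then have "Q u = 0"
      using self_adjointD[OF Q, of u "Q u"] by (simp add: cinner_self_eq_0)
    then show "u \<in> closure V"
      using mem[of u 0] by (simp add: blinfun.zero_right)
  qed
  moreover have "closure V \<subseteq> C"
    by (rule closure_minimal[OF _ C]) (auto simp: V_def sub)
  ultimately show ?thesis
    by blast
qed

text \<open>On the dense set of vectors n + |T| y with \<open>n\<close> in the kernel,
  \<open>W\<close> is explicit: it sends such a vector to T y. Symmetry and the norm bound are
  checked there and extended by continuity.\<close>

lemma polar_factor:
  fixes T W :: "'a::complex_hilbert_space \<Rightarrow>\<^sub>L 'a"
  assumes T: "self_adjoint T" and W: "polar_decomposition T W"
  shows polar_factor_apply: "W (op_abs T x) = T x"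
    and polar_factor_self_adjoint: "self_adjoint W"
    and polar_factor_norm_le: "norm (W x) \<le> norm x"
    and polar_factor_commute: "op_abs T (W x) = W (op_abs T x)"
proof -
  define P where "P = op_abs T"
  have saP: "self_adjoint P"
    unfolding P_def by (rule positive_opD(1)[OF positive_op_abs[OF T]])
  have "T = W o\<^sub>L P"
    using W unfolding polar_decomposition_def P_def by blast
  then have WP: "W (P x) = T x" for x
    by simp
  show "W (op_abs T x) = T x"
    using WP by (simp add: P_def)
  have PT: "norm (P x) = norm (T x)" for x
    unfolding P_def by (rule norm_op_abs[OF T])
  have null: "T n = 0 \<and> W n = 0" if "P n = 0" for n
  proof -
    have "T n = 0"
      using PT[of n] that by simp
    moreover have "null_space W = null_space T"
      using W by (simp add: polar_decomposition_def)
    ultimately show ?thesis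
      by (auto simp: null_space_def)
  qed
  have comm: "P (T x) = T (P x)" for x
    unfolding P_def by (rule op_abs_commute[OF T]) simp
  have sa: "cinner (W x) y = cinner x (W y)" for x y
  proof -
    \<comment> \<open>Both arguments are first restricted to the dense set;
      \<open>null_range_dense\<close> then frees one argument at a time.\<close>
    have 1: "cinner (W (n + P x')) (m + P y') = cinner (n + P x') (W (m + P y'))"
      if "P n = 0" "P m = 0" for n m x' y'
    proof -
      have "cinner (W (n + P x')) (m + P y') = cinner x' (T m) + cinner x' (T (P y'))"
        using null[OF that(1)] by (simp add: blinfun.add_right WP cinner.add_right self_adjointD[OF T])
      also have "\<dots> = cinner (T n) y' + cinner x' (P (T y'))"
        using null[OF that(1)] null[OF that(2)] by (simp add: comm cinner.zero_left cinner.zero_right)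
      also have "\<dots> = cinner (n + P x') (W (m + P y'))"
        using null[OF that(2)]
        by (simp add: blinfun.add_right WP cinner.add_left self_adjointD[OF T] self_adjointD[OF saP])
      finally show ?thesis .
    qed
    have 2: "cinner (W (n + P x')) y = cinner (n + P x') (W y)" if "P n = 0" for n x' y
    proof -
      have "y \<in> {y. cinner (W (n + P x')) y = cinner (n + P x') (W y)}"
        by (rule null_range_dense[OF saP])
          (use 1[OF that] in \<open>auto intro!: closed_Collect_eq cinner.continuous_on continuous_intros\<close>)
      then show ?thesis
        by simp
    qed
    have "x \<in> {x. cinner (W x) y = cinner x (W y)}"
      by (rule null_range_dense[OF saP])
        (use 2 in \<open>auto intro!: closed_Collect_eq cinner.continuous_on continuous_intros\<close>)
    then show ?thesis
      by simp
  qed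
  show saW: "self_adjoint W"
    by (rule self_adjointI) (use W sa in \<open>simp_all add: polar_decomposition_def partial_isometry_def\<close>)
  have "x \<in> {x. norm (W x) \<le> norm x}"
  proof (rule null_range_dense[OF saP])
    show "closed {x. norm (W x) \<le> norm x}"
      by (intro closed_Collect_le continuous_intros)
    fix n y assume n: "P n = 0"
    have "cinner n (P y) = 0"
      using self_adjointD[OF saP, of n y] n by (simp add: cinner.zero_left)
    then have "(norm (P y))\<^sup>2 \<le> (norm (n + P y))\<^sup>2"
      by (simp add: norm_add_squared)
    then have "norm (P y) \<le> norm (n + P y)"
      using power2_le_imp_le norm_ge_zero by blast
    then show "n + P y \<in> {x. norm (W x) \<le> norm x}"
      using null[OF n] by (simp add: blinfun.add_right WP PT)
  qed
  then show "norm (W x) \<le> norm x"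
    by simp
  \<comment> \<open>This is the adjoint of \<open>W (P x) = T x\<close>, all three operators being
    self-adjoint.\<close>
  have "P (W x) = T x"
  proof -
    have "cinner y (P (W x) - T x) = 0" for y
      using self_adjointD[OF saP, of y "W x"] self_adjointD[OF saW, of "P y" x] self_adjointD[OF T, of y x]
      by (simp add: WP cinner.diff_right)
    then show ?thesis
      using cinner_self_eq_0[of "P (W x) - T x"] by simp
  qed
  then show "op_abs T (W x) = W (op_abs T x)"
    using WP by (simp add: P_def)
qed

text \<open>The positive part (|K| + K)/2 equals \<open>K + negative_part K\<close>, so it receives
  no name of its own.\<close>

definition negative_part :: "('a::complex_hilbert_space \<Rightarrow>\<^sub>L 'a) \<Rightarrow> 'a \<Rightarrow>\<^sub>L 'a" where
  "negative_part K = (1/2) *\<^sub>R (op_abs K - K)"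

lemma negative_part_apply: "blinfun_apply (negative_part K) x = (1/2) *\<^sub>R (op_abs K x - K x)"
  by (simp add: negative_part_def blinfun.scaleR_left blinfun.diff_left)

text \<open>Writing L for the negative part, |K|^2 = K^2 gives K L = -L^2, so L annihilates K + L,
  and also |K| L = L^2. Only positivity of L goes beyond algebra: L vanishes on the kernel of |K|,
  and on its range <L |K| y, |K| y> = <|K| L y, L y> \<ge> 0.\<close>

lemma negative_part:
  fixes K :: "'a::complex_hilbert_space \<Rightarrow>\<^sub>L 'a"
  assumes K: "self_adjoint K"
  shows self_adjoint_negative_part: "self_adjoint (negative_part K)"
    and negative_part_commute: "\<And>(B::'a \<Rightarrow>\<^sub>L 'a) x. (\<And>x. K (B x) = B (K x)) \<Longrightarrow>
      negative_part K (B x) = B (negative_part K x)"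
    and norm_negative_part_le: "norm (negative_part K x) \<le> norm (K x)"
    and negative_part_mult: "K (negative_part K x) = - negative_part K (negative_part K x)"
    and negative_part_nonneg: "0 \<le> Re (cinner (negative_part K x) x)"
proof -
  define Q where "Q = op_abs K"
  note Q = positive_op_abs[OF K, folded Q_def]
  have L: "negative_part K x = (1/2) *\<^sub>R (Q x - K x)" for x
    by (simp add: negative_part_apply Q_def)
  have comm: "Q (K x) = K (Q x)" and QQ: "Q (Q x) = K (K x)" for x
    unfolding Q_def by (auto intro: op_abs_commute[OF K] op_abs_op_abs[OF K])
  show saL: "self_adjoint (negative_part K)"
    unfolding negative_part_def Q_def[symmetric]
    by (intro self_adjoint_scaleR self_adjoint_diff positive_opD(1)[OF Q] K)
  show commL: "negative_part K (B x) = B (negative_part K x)" if "\<And>x. K (B x) = B (K x)"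
    for B :: "'a \<Rightarrow>\<^sub>L 'a" and x
    using op_abs_commute[OF K that] that
    by (simp add: negative_part_apply blinfun.scaleR_right blinfun.diff_right)
  show "norm (negative_part K x) \<le> norm (K x)"
    using norm_triangle_ineq4[of "Q x" "K x"] norm_op_abs[OF K, of x] by (simp add: L Q_def)
  have KL: "K (negative_part K x) = - negative_part K (negative_part K x)" for x
  proof -
    have half: "(1/2) *\<^sub>R z = (1/4) *\<^sub>R z + (1/4) *\<^sub>R z" for z :: 'a
      by (simp flip: scaleR_left_distrib)
    show ?thesis
      by (simp add: L blinfun.scaleR_right blinfun.diff_right comm QQ scaleR_right_diff_distrib
          half[of "K (Q x)"] half[of "K (K x)"])
  qed
  show "K (negative_part K x) = - negative_part K (negative_part K x)"
    by (rule KL)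
  have QL: "Q (negative_part K x) = negative_part K (negative_part K x)" for x
  proof -
    have "2 *\<^sub>R negative_part K (negative_part K x) = Q (negative_part K x) - K (negative_part K x)"
      unfolding L[of "negative_part K x"] by simp
    then show ?thesis
      by (simp add: KL scaleR_2)
  qed
  have LQ: "negative_part K (Q x) = Q (negative_part K x)" for x
    by (simp add: L blinfun.scaleR_right blinfun.diff_right comm)
  have "x \<in> {x. 0 \<le> Re (cinner (negative_part K x) x)}"
  proof (rule null_range_dense[OF positive_opD(1)[OF Q]])
    show "closed {x. 0 \<le> Re (cinner (negative_part K x) x)}"
      by (intro closed_Collect_le continuous_intros cinner.continuous_on)
    fix n y assume n: "Q n = 0"
    then have Ln: "negative_part K n = 0"
      using norm_op_abs[OF K, of n] by (simp add: L Q_def)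
    have "cinner (negative_part K (n + Q y)) (n + Q y) =
        cinner (Q y) (negative_part K n) + cinner (negative_part K (Q y)) (Q y)"
      using Ln by (simp add: blinfun.add_right cinner.add_right self_adjointD[OF saL])
    also have "\<dots> = cinner (Q (negative_part K y)) (negative_part K y)"
    proof -
      have "cinner (negative_part K (Q y)) (Q y) = cinner (Q (negative_part K (negative_part K y))) y"
        by (simp add: LQ QL self_adjointD[OF positive_opD(1)[OF Q], of _ y, symmetric])
      also have "\<dots> = cinner (Q (negative_part K y)) (negative_part K y)"
        by (simp add: LQ[symmetric] self_adjointD[OF saL])
      finally show ?thesis
        using Ln by (simp add: cinner.zero_right)
    qed
    finally show "n + Q y \<in> {x. 0 \<le> Re (cinner (negative_part K x) x)}"
      using positive_opD(2)[OF Q] by simp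
  qed
  then show "0 \<le> Re (cinner (negative_part K x) x)"
    by simp
qed

text \<open>From K L = -L^2 follows P L = \<alpha> L - L^2. Moving the root of \<open>P\<close>
  across L shows that P L has a nonnegative form, hence L^2 \<le> \<alpha> L, and the Cauchy-Schwarz
  inequality turns this into a norm bound.\<close>

lemma negative_part_norm_le:
  fixes P :: "'a::complex_hilbert_space \<Rightarrow>\<^sub>L 'a"
  assumes P: "positive_op P" and \<alpha>: "\<alpha> \<ge> 0"
  shows "norm (negative_part (P - \<alpha> *\<^sub>R id_blinfun) x) \<le> \<alpha> * norm x"
proof -
  define K where "K = P - \<alpha> *\<^sub>R id_blinfun"
  have saK: "self_adjoint K"
    unfolding K_def by (intro self_adjoint_diff self_adjoint_scaleR self_adjoint_id positive_opD(1) P)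
  define L where "L = negative_part K"
  define R where "R = op_sqrt P"
  have saR: "self_adjoint R"
    unfolding R_def by (rule positive_opD(1)[OF positive_op_sqrt[OF P]])
  have RR: "P z = R (R z)" for z
    using arg_cong[OF op_sqrt_square[OF P], of "\<lambda>F. blinfun_apply F z"] by (simp add: R_def)
  have "K (P z) = P (K z)" for z
    by (simp add: K_def blinfun.diff_left blinfun.scaleR_left blinfun.diff_right blinfun.scaleR_right)
  then have "P (L z) = L (P z)" for z
    unfolding L_def using negative_part_commute[OF saK, of P] by simp
  then have RL: "R (L z) = L (R z)" for z
    unfolding R_def by (rule op_sqrt_commute[OF P])
  have PL: "P (L x) = \<alpha> *\<^sub>R L x - L (L x)"
    using negative_part_mult[OF saK, of x]
    by (simp add: K_def L_def blinfun.diff_left blinfun.scaleR_left algebra_simps)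
  have "cinner (P (L x)) x = cinner (L (R x)) (R x)"
    using self_adjointD[OF saR, of "R (L x)" x] by (simp add: RR RL)
  then have "0 \<le> Re (cinner (P (L x)) x)"
    using negative_part_nonneg[OF saK] by (simp add: L_def)
  then have "(norm (L x))\<^sup>2 \<le> \<alpha> * Re (cinner (L x) x)"
    using cinner_square[OF self_adjoint_negative_part[OF saK, folded L_def], of x]
    by (simp add: PL cinner.diff_left cinner.scaleR_left)
  also have "\<dots> \<le> \<alpha> * (norm (L x) * norm x)"
    using \<alpha> norm_cinner_le complex_Re_le_cmod order_trans by (intro mult_left_mono) blast+
  finally show ?thesis
    by (cases "L x = 0") (use \<alpha> in \<open>simp_all add: L_def K_def power2_eq_square mult.left_commute\<close>)
qed

theorem theorem5p2:
  fixes T W :: "'a::complex_hilbert_space \<Rightarrow>\<^sub>L 'a"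
  assumes infinite_dim: "\<not> (\<exists>B::'a set. finite B \<and> complex_vector.span B = UNIV)"
    and T_closure: "T \<in> closure AN_ops"
    and T_sa: "self_adjoint T"
    and polar: "polar_decomposition T W"
  shows "\<exists>(\<alpha>::real) K\<^sub>1 K\<^sub>2.
           \<alpha> \<ge> 0 \<and>
           self_adjoint K\<^sub>1 \<and> compact_op K\<^sub>1 \<and>
           self_adjoint K\<^sub>2 \<and> compact_op K\<^sub>2 \<and>
           T = \<alpha> *\<^sub>R W - K\<^sub>1 + K\<^sub>2 \<and>
           K\<^sub>1 o\<^sub>L K\<^sub>2 = 0 \<and>
           op_le (K\<^sub>1 o\<^sub>L K\<^sub>1) (\<alpha>\<^sup>2 *\<^sub>R id_blinfun)"
proof -
  obtain \<alpha> where \<alpha>: "\<alpha> \<ge> 0" "small_off_finite (op_abs T - \<alpha> *\<^sub>R id_blinfun)"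
    using closure_AN_op_abs[OF infinite_dim T_closure T_sa] .
  define P where "P = op_abs T"
  define K where "K = P - \<alpha> *\<^sub>R id_blinfun"
  define L where "L = negative_part K"
  define K1 where "K1 = W o\<^sub>L L"
  define K2 where "K2 = W o\<^sub>L (K + L)"
  note P = positive_op_abs[OF T_sa, folded P_def]
  note polar_factor = polar_factor[OF T_sa polar, folded P_def]
  have saK: "self_adjoint K"
    unfolding K_def by (intro self_adjoint_diff self_adjoint_scaleR self_adjoint_id positive_opD(1) P)
  have saL: "self_adjoint L"
    unfolding L_def by (rule self_adjoint_negative_part[OF saK])
  have small: "small_off_finite K"
    using \<alpha>(2) by (simp add: K_def P_def)
  have KW: "K (W x) = W (K x)" for x
    by (simp add: K_def blinfun.diff_left blinfun.scaleR_left blinfun.diff_right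
        blinfun.scaleR_right polar_factor(4))
  then have LW: "L (W x) = W (L x)" for x
    unfolding L_def by (rule negative_part_commute[OF saK])
  have KL: "K (L x) = - L (L x)" for x
    unfolding L_def by (rule negative_part_mult[OF saK])
  have LK: "L (K x) = K (L x)" for x
    unfolding L_def by (rule negative_part_commute[OF saK refl])
  have normL: "norm (L x) \<le> norm (K x)" for x
    unfolding L_def by (rule norm_negative_part_le[OF saK])
  have saK1: "self_adjoint K1" and saK2: "self_adjoint K2"
    unfolding K1_def K2_def
    by (intro self_adjoint_compose_commute self_adjoint_add polar_factor(2) saK saL;
        simp add: KW LW blinfun.add_left blinfun.add_right)+
  \<comment> \<open>Both summands inherit compactness from \<open>K\<close> by domination, as
    \<open>W\<close> is a contraction and \<open>L x\<close> is no longer than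
    \<open>K x\<close>.\<close>
  have "norm (K1 x) \<le> 1 * norm (K x)" for x
    using polar_factor(3)[of "L x"] normL[of x] by (simp add: K1_def)
  then have cK1: "compact_op K1"
    by (intro small_off_finite_imp_compact_op self_adjoint_bounded_ops saK1
        small_off_finite_dominated[OF small])
  have "norm (K2 x) \<le> 2 * norm (K x)" for x
    using polar_factor(3)[of "K x + L x"] normL[of x] norm_triangle_ineq[of "K x" "L x"]
    by (simp add: K2_def blinfun.add_left)
  then have cK2: "compact_op K2"
    by (intro small_off_finite_imp_compact_op self_adjoint_bounded_ops saK2
        small_off_finite_dominated[OF small])
  have "T = \<alpha> *\<^sub>R W - K1 + K2"
  proof (rule blinfun_eqI)
    fix x
    have "T x = W (\<alpha> *\<^sub>R x + K x)"
      by (simp add: K_def blinfun.diff_left blinfun.scaleR_left polar_factor(1))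
    then show "T x = (\<alpha> *\<^sub>R W - K1 + K2) x"
      by (simp add: K1_def K2_def blinfun.add_left blinfun.diff_left blinfun.scaleR_left
          blinfun.add_right blinfun.scaleR_right)
  qed
  moreover have "K1 o\<^sub>L K2 = 0"
  proof (rule blinfun_eqI)
    fix x
    have "L (K x + L x) = 0"
      by (simp add: blinfun.add_right LK KL)
    then show "(K1 o\<^sub>L K2) x = blinfun_apply 0 x"
      by (simp add: K1_def K2_def LW blinfun.add_left blinfun.zero_right)
  qed
  moreover have "op_le (K1 o\<^sub>L K1) (\<alpha>\<^sup>2 *\<^sub>R id_blinfun)"
    unfolding op_le_def positive_op_def
  proof (intro conjI allI)
    show sq: "self_adjoint (K1 o\<^sub>L K1)" and id: "self_adjoint (\<alpha>\<^sup>2 *\<^sub>R id_blinfun :: 'a \<Rightarrow>\<^sub>L 'a)"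
      by (intro self_adjoint_compose_commute self_adjoint_scaleR self_adjoint_id saK1 refl)+
    show "self_adjoint (\<alpha>\<^sup>2 *\<^sub>R id_blinfun - (K1 o\<^sub>L K1))"
      by (intro self_adjoint_diff sq id)
    fix x
    have "norm (K1 x) \<le> \<alpha> * norm x"
      using polar_factor(3)[of "L x"] negative_part_norm_le[OF P \<alpha>(1), of x]
      by (simp add: K1_def L_def K_def)
    then have "(norm (K1 x))\<^sup>2 \<le> (\<alpha> * norm x)\<^sup>2"
      by (intro power_mono) simp_all
    then show "0 \<le> Re (cinner ((\<alpha>\<^sup>2 *\<^sub>R id_blinfun - (K1 o\<^sub>L K1)) x) x)"
      by (simp add: blinfun.diff_left blinfun.scaleR_left cinner.diff_left cinner.scaleR_left
          cinner_square[OF saK1] cinner_self power_mult_distrib)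
  qed
  ultimately show ?thesis
    using \<alpha>(1) saK1 saK2 cK1 cK2 by blast
qed

end
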